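(* The category $\mathsf{Ind}(\mathsf{Set}_{\mathbf{L}}^\omega)$ is categorically equivalent to $\mathsf{Set}_{\mathbf{L}}$.
   Context: Setting: $\mathbf{L}$ is a finite algebra with an underlying bounded lattice $(L,\wedge,\vee,0,1)$, $0\neq 1$ (the lattice operations and the bounds belong to the signature of $\mathbf{L}$, so every subalgebra contains $0,1$), and $\mathbf{L}$ is semi-primal: for every $n\ge 1$, every function $f\colon L^n\to L$ that preserves subalgebras (meaning $f(a_1,\dots,a_n)$ always lies in the subalgebra generated by $a_1,\dots,a_n$) is term-definable in $\mathbf{L}$. $\mathbb{S}(\mathbf{L})$ is the finite lattice of subalgebras of $\mathbf{L}$ ordered by inclusion. The category $\mathsf{Set}_{\mathbf{L}}$ has as objects pairs $(X,v)$ with $X$ a set and $v\colon X\to\mathbb{S}(\mathbf{L})$ an arbitrary map; morphisms $(X,v)\to(Y,w)$ are maps $m\colon X\to Y$ with $w(m(x))\le v(x)$ for all $x\in X$. $\mathsf{Set}_{\mathbf{L}}^\omega$ is the full subcategory of those $(X,v)$ with $X$ finite. $\mathsf{Ind}(\mathsf{C})$ denotes the (free) completion of a category $\mathsf{C}$ under filtered colimits. *)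

theory Defs
  imports Main "HOL-Library.FuncSet"
begin

text \<open>
  Hom-sets of different pairs of objects need not be disjoint; this is why composition and the
  arrow part of a functor take the objects involved as arguments: \<open>Comp C a b c g f\<close> is
  \<open>g \<circ> f\<close> for \<open>f : a \<rightarrow> b\<close> and \<open>g : b \<rightarrow> c\<close>.
\<close>

record ('o, 'm) cat =
  Obj :: "'o set"
  Hom :: "'o \<Rightarrow> 'o \<Rightarrow> 'm set"
  Ident :: "'o \<Rightarrow> 'm"
  Comp :: "'o \<Rightarrow> 'o \<Rightarrow> 'o \<Rightarrow> 'm \<Rightarrow> 'm \<Rightarrow> 'm"

locale category =
  fixes C :: "('o, 'm) cat"
  assumes Ident_in_Hom: "a \<in> Obj C \<Longrightarrow> Ident C a \<in> Hom C a a"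
    and Comp_in_Hom: "\<lbrakk>a \<in> Obj C; b \<in> Obj C; c \<in> Obj C; f \<in> Hom C a b; g \<in> Hom C b c\<rbrakk>
      \<Longrightarrow> Comp C a b c g f \<in> Hom C a c"
    and Comp_Ident_left: "\<lbrakk>a \<in> Obj C; b \<in> Obj C; f \<in> Hom C a b\<rbrakk>
      \<Longrightarrow> Comp C a b b (Ident C b) f = f"
    and Comp_Ident_right: "\<lbrakk>a \<in> Obj C; b \<in> Obj C; f \<in> Hom C a b\<rbrakk>
      \<Longrightarrow> Comp C a a b f (Ident C a) = f"
    and Comp_assoc: "\<lbrakk>a \<in> Obj C; b \<in> Obj C; c \<in> Obj C; d \<in> Obj C;
        f \<in> Hom C a b; g \<in> Hom C b c; h \<in> Hom C c d\<rbrakk>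
      \<Longrightarrow> Comp C a b d (Comp C b c d h g) f = Comp C a c d h (Comp C a b c g f)"

definition full_subcategory :: "('o, 'm) cat \<Rightarrow> ('o \<Rightarrow> bool) \<Rightarrow> ('o, 'm) cat" where
  "full_subcategory C P = C\<lparr>Obj := {a \<in> Obj C. P a}\<rparr>"

record ('o, 'm, 'p, 'n) func =
  on_obj :: "'o \<Rightarrow> 'p"
  on_arr :: "'o \<Rightarrow> 'o \<Rightarrow> 'm \<Rightarrow> 'n"

locale is_functor =
  fixes C :: "('o, 'm) cat" and D :: "('p, 'n) cat" and F :: "('o, 'm, 'p, 'n) func"
  assumes on_obj_in_Obj: "a \<in> Obj C \<Longrightarrow> on_obj F a \<in> Obj D"
    and on_arr_in_Hom: "\<lbrakk>a \<in> Obj C; b \<in> Obj C; f \<in> Hom C a b\<rbrakk>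
      \<Longrightarrow> on_arr F a b f \<in> Hom D (on_obj F a) (on_obj F b)"
    and on_arr_Ident: "a \<in> Obj C \<Longrightarrow> on_arr F a a (Ident C a) = Ident D (on_obj F a)"
    and on_arr_Comp: "\<lbrakk>a \<in> Obj C; b \<in> Obj C; c \<in> Obj C; f \<in> Hom C a b; g \<in> Hom C b c\<rbrakk>
      \<Longrightarrow> on_arr F a c (Comp C a b c g f) =
          Comp D (on_obj F a) (on_obj F b) (on_obj F c) (on_arr F b c g) (on_arr F a b f)"

definition id_functor :: "('o, 'm, 'o, 'm) func" where
  "id_functor = \<lparr>on_obj = (\<lambda>a. a), on_arr = (\<lambda>a b f. f)\<rparr>"

definition comp_functor ::
  "('p, 'n, 'q, 'k) func \<Rightarrow> ('o, 'm, 'p, 'n) func \<Rightarrow> ('o, 'm, 'q, 'k) func" where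
  "comp_functor G F = \<lparr>on_obj = (\<lambda>a. on_obj G (on_obj F a)),
     on_arr = (\<lambda>a b f. on_arr G (on_obj F a) (on_obj F b) (on_arr F a b f))\<rparr>"

definition is_iso :: "('o, 'm) cat \<Rightarrow> 'o \<Rightarrow> 'o \<Rightarrow> 'm \<Rightarrow> bool" where
  "is_iso C a b f \<longleftrightarrow> f \<in> Hom C a b \<and>
     (\<exists>g \<in> Hom C b a. Comp C a b a g f = Ident C a \<and> Comp C b a b f g = Ident C b)"

definition naturally_isomorphic ::
  "('o, 'm) cat \<Rightarrow> ('p, 'n) cat \<Rightarrow> ('o, 'm, 'p, 'n) func \<Rightarrow> ('o, 'm, 'p, 'n) func \<Rightarrow> bool" where
  "naturally_isomorphic C D F G \<longleftrightarrow>
     (\<exists>\<eta>. (\<forall>a \<in> Obj C. is_iso D (on_obj F a) (on_obj G a) (\<eta> a)) \<and>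
       (\<forall>a \<in> Obj C. \<forall>b \<in> Obj C. \<forall>f \<in> Hom C a b.
          Comp D (on_obj F a) (on_obj F b) (on_obj G b) (\<eta> b) (on_arr F a b f) =
          Comp D (on_obj F a) (on_obj G a) (on_obj G b) (on_arr G a b f) (\<eta> a)))"

definition equivalent_categories :: "('o, 'm) cat \<Rightarrow> ('p, 'n) cat \<Rightarrow> bool" where
  "equivalent_categories C D \<longleftrightarrow> category C \<and> category D \<and>
     (\<exists>F G. is_functor C D F \<and> is_functor D C G \<and>
        naturally_isomorphic C C (comp_functor G F) id_functor \<and>
        naturally_isomorphic D D (comp_functor F G) id_functor)"

text \<open>
  A universe of small sets whose elements are taken from the type \<open>'u\<close>. Only the closure
  properties below are required, so that for every infinite type one may take
  \<open>U = UNIV\<close>, or, for an uncountable cardinal, all sets of smaller cardinality. A Grothendieck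
  universe containing an infinite set satisfies them, too.
\<close>

definition set_universe :: "'u set set \<Rightarrow> bool" where
  "set_universe U \<longleftrightarrow>
     (\<forall>A \<in> U. \<forall>B. B \<subseteq> A \<longrightarrow> B \<in> U) \<and>
     (\<forall>A \<in> U. \<forall>g :: 'u \<Rightarrow> 'u. g ` A \<in> U) \<and>
     (\<exists>A \<in> U. infinite A)"

definition filtered_category :: "('o, 'm) cat \<Rightarrow> bool" where
  "filtered_category I \<longleftrightarrow> category I \<and> Obj I \<noteq> {} \<and>
     (\<forall>i \<in> Obj I. \<forall>j \<in> Obj I. \<exists>k \<in> Obj I. Hom I i k \<noteq> {} \<and> Hom I j k \<noteq> {}) \<and>
     (\<forall>i \<in> Obj I. \<forall>j \<in> Obj I. \<forall>p \<in> Hom I i j. \<forall>q \<in> Hom I i j.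
        \<exists>k \<in> Obj I. \<exists>r \<in> Hom I j k. Comp I i j k r p = Comp I i j k r q)"

definition small_category :: "'u set set \<Rightarrow> ('u, 'u) cat \<Rightarrow> bool" where
  "small_category U I \<longleftrightarrow> category I \<and> Obj I \<in> U \<and>
     (\<forall>i \<in> Obj I. \<forall>j \<in> Obj I. Hom I i j \<in> U)"

text \<open>
  \<open>Ind U C\<close> below is Grothendieck's construction of the free completion of \<open>C\<close> under
  (small) filtered colimits: an object is a small filtered diagram in \<open>C\<close>, standing for its
  formal colimit.
\<close>

type_synonym ('u, 'o, 'm) diagram = "('u, 'u) cat \<times> ('u, 'u, 'o, 'm) func"

definition filtered_diagrams :: "'u set set \<Rightarrow> ('o, 'm) cat \<Rightarrow> ('u, 'o, 'm) diagram set" where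
  "filtered_diagrams U C =
     {(I, X). small_category U I \<and> filtered_category I \<and> is_functor I C X}"

text \<open>
  \<open>colim_hom C c (J, Y)\<close> is the set \<open>colim\<^sub>j Hom(c, Y j)\<close>, the quotient of the
  pairs \<open>(j, f)\<close> with \<open>f : c \<rightarrow> Y j\<close> that identifies \<open>(j, f)\<close> and \<open>(j', f')\<close> if
  they become equal at a later stage \<open>k\<close>.
\<close>

definition germs :: "('o, 'm) cat \<Rightarrow> 'o \<Rightarrow> ('u, 'o, 'm) diagram \<Rightarrow> ('u \<times> 'm) set" where
  "germs C c = (\<lambda>(J, Y). SIGMA j : Obj J. Hom C c (on_obj Y j))"

definition germ_rel ::
  "('o, 'm) cat \<Rightarrow> 'o \<Rightarrow> ('u, 'o, 'm) diagram \<Rightarrow> (('u \<times> 'm) \<times> ('u \<times> 'm)) set" where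
  "germ_rel C c = (\<lambda>(J, Y).
     {((j, f), (j', f')). (j, f) \<in> germs C c (J, Y) \<and> (j', f') \<in> germs C c (J, Y) \<and>
        (\<exists>k \<in> Obj J. \<exists>p \<in> Hom J j k. \<exists>q \<in> Hom J j' k.
           Comp C c (on_obj Y j) (on_obj Y k) (on_arr Y j k p) f =
           Comp C c (on_obj Y j') (on_obj Y k) (on_arr Y j' k q) f')})"

definition colim_hom :: "('o, 'm) cat \<Rightarrow> 'o \<Rightarrow> ('u, 'o, 'm) diagram \<Rightarrow> ('u \<times> 'm) set set" where
  "colim_hom C c D = germs C c D // germ_rel C c D"

definition germ_class ::
  "('o, 'm) cat \<Rightarrow> 'o \<Rightarrow> ('u, 'o, 'm) diagram \<Rightarrow> 'u \<times> 'm \<Rightarrow> ('u \<times> 'm) set" where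
  "germ_class C c D x = germ_rel C c D `` {x}"

text \<open>The action \<open>colim_hom C c' D \<rightarrow> colim_hom C c D\<close> of an arrow \<open>u : c \<rightarrow> c'\<close>:
  the union is over representatives, all of which yield the same class.\<close>

definition colim_hom_pre ::
  "('o, 'm) cat \<Rightarrow> ('u, 'o, 'm) diagram \<Rightarrow> 'o \<Rightarrow> 'o \<Rightarrow> 'm \<Rightarrow> ('u \<times> 'm) set \<Rightarrow> ('u \<times> 'm) set"
  where
  "colim_hom_pre C D c c' u \<gamma> =
     (\<Union>(j, f) \<in> \<gamma>. germ_class C c D (j, Comp C c c' (on_obj (snd D) j) f u))"

text \<open>
  \<open>Hom((I, X), (J, Y)) = lim\<^sub>i colim\<^sub>j Hom(X i, Y j)\<close>: an arrow is a compatible family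
  \<open>\<phi> i \<in> colim\<^sub>j Hom(X i, Y j)\<close>. Composition is computed on representatives.
\<close>

definition ind_hom ::
  "('o, 'm) cat \<Rightarrow> ('u, 'o, 'm) diagram \<Rightarrow> ('u, 'o, 'm) diagram \<Rightarrow> ('u \<Rightarrow> ('u \<times> 'm) set) set"
  where
  "ind_hom C = (\<lambda>(I, X) D.
     {\<phi> \<in> (\<Pi>\<^sub>E i \<in> Obj I. colim_hom C (on_obj X i) D).
        \<forall>i \<in> Obj I. \<forall>i' \<in> Obj I. \<forall>u \<in> Hom I i i'.
          colim_hom_pre C D (on_obj X i) (on_obj X i') (on_arr X i i' u) (\<phi> i') = \<phi> i})"

definition Ind ::
  "'u set set \<Rightarrow> ('o, 'm) cat \<Rightarrow> (('u, 'o, 'm) diagram, 'u \<Rightarrow> ('u \<times> 'm) set) cat" where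
  "Ind U C = \<lparr>
     Obj = filtered_diagrams U C,
     Hom = ind_hom C,
     Ident = (\<lambda>(I, X). \<lambda>i \<in> Obj I.
       germ_class C (on_obj X i) (I, X) (i, Ident C (on_obj X i))),
     Comp = (\<lambda>(I, X) (J, Y) (K, Z) \<psi> \<phi>. \<lambda>i \<in> Obj I.
       \<Union>(j, f) \<in> \<phi> i. \<Union>(k, g) \<in> \<psi> j.
         germ_class C (on_obj X i) (K, Z)
           (k, Comp C (on_obj X i) (on_obj Y j) (on_obj Z k) g f))\<rparr>"

text \<open>
  The type \<open>'f\<close> is the set of operation symbols and the type \<open>'l\<close> the underlying set
  of the algebra; the value of \<open>oper L s\<close> is relevant only on lists of length \<open>arity L s\<close>.
\<close>

record ('f, 'l) algebra =
  arity :: "'f \<Rightarrow> nat"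
  oper :: "'f \<Rightarrow> 'l list \<Rightarrow> 'l"

definition bounded_lattice_in_signature :: "('f, 'l :: bounded_lattice) algebra \<Rightarrow> bool" where
  "bounded_lattice_in_signature L \<longleftrightarrow>
     (\<exists>s. arity L s = 2 \<and> (\<forall>x y. oper L s [x, y] = inf x y)) \<and>
     (\<exists>s. arity L s = 2 \<and> (\<forall>x y. oper L s [x, y] = sup x y)) \<and>
     (\<exists>s. arity L s = 0 \<and> oper L s [] = bot) \<and>
     (\<exists>s. arity L s = 0 \<and> oper L s [] = top)"

definition subalgebras :: "('f, 'l) algebra \<Rightarrow> 'l set set" where
  "subalgebras L =
     {S. \<forall>s xs. length xs = arity L s \<longrightarrow> set xs \<subseteq> S \<longrightarrow> oper L s xs \<in> S}"

definition generated_subalgebra :: "('f, 'l) algebra \<Rightarrow> 'l set \<Rightarrow> 'l set" where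
  "generated_subalgebra L A = \<Inter>{S \<in> subalgebras L. A \<subseteq> S}"

datatype 'f trm = Var nat | App 'f "'f trm list"

primrec term_over :: "('f, 'l) algebra \<Rightarrow> nat \<Rightarrow> 'f trm \<Rightarrow> bool" where
  "term_over L n (Var i) \<longleftrightarrow> i < n"
| "term_over L n (App s ts) \<longleftrightarrow> length ts = arity L s \<and> list_all (term_over L n) ts"

primrec eval_term :: "('f, 'l) algebra \<Rightarrow> 'l list \<Rightarrow> 'f trm \<Rightarrow> 'l" where
  "eval_term L xs (Var i) = xs ! i"
| "eval_term L xs (App s ts) = oper L s (map (eval_term L xs) ts)"

definition preserves_subalgebras :: "('f, 'l) algebra \<Rightarrow> nat \<Rightarrow> ('l list \<Rightarrow> 'l) \<Rightarrow> bool" where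
  "preserves_subalgebras L n f \<longleftrightarrow>
     (\<forall>xs. length xs = n \<longrightarrow> f xs \<in> generated_subalgebra L (set xs))"

definition term_definable :: "('f, 'l) algebra \<Rightarrow> nat \<Rightarrow> ('l list \<Rightarrow> 'l) \<Rightarrow> bool" where
  "term_definable L n f \<longleftrightarrow>
     (\<exists>t. term_over L n t \<and> (\<forall>xs. length xs = n \<longrightarrow> eval_term L xs t = f xs))"

definition semi_primal :: "('f, 'l) algebra \<Rightarrow> bool" where
  "semi_primal L \<longleftrightarrow>
     (\<forall>n \<ge> 1. \<forall>f. preserves_subalgebras L n f \<longrightarrow> term_definable L n f)"

text \<open>Maps are represented by extensional functions, so that equality of objects and of arrows
  does not depend on values outside the domain.\<close>

definition Set_L ::
  "'u set set \<Rightarrow> ('f, 'l) algebra \<Rightarrow> ('u set \<times> ('u \<Rightarrow> 'l set), 'u \<Rightarrow> 'u) cat" where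
  "Set_L U L = \<lparr>
     Obj = {(X, v). X \<in> U \<and> v \<in> X \<rightarrow>\<^sub>E subalgebras L},
     Hom = (\<lambda>(X, v) (Y, w). {m \<in> X \<rightarrow>\<^sub>E Y. \<forall>x \<in> X. w (m x) \<subseteq> v x}),
     Ident = (\<lambda>(X, v). \<lambda>x \<in> X. x),
     Comp = (\<lambda>(X, v) _ _ g f. compose X g f)\<rparr>"

definition Set_L_fin ::
  "'u set set \<Rightarrow> ('f, 'l) algebra \<Rightarrow> ('u set \<times> ('u \<Rightarrow> 'l set), 'u \<Rightarrow> 'u) cat" where
  "Set_L_fin U L = full_subcategory (Set_L U L) (\<lambda>(X, v). finite X)"

end

theory Submission
  imports Defs
begin

text \<open>
  Every filtered diagram of finite objects has a colimit in \<open>Set_L\<close>: take the colimit of the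
  underlying sets and label a point with the intersection of the labels of its representatives.
  As there are finitely many subalgebras and the diagram is filtered, this intersection is the label
  of one of the representatives. Hence an arrow from a finite object to such a colimit factors
  through a stage of the diagram, essentially uniquely, that is, finite objects are finitely
  presentable. Therefore taking colimits is a full and faithful functor
  \<open>Ind (Set_L_fin) \<rightarrow> Set_L\<close>, and it is essentially surjective because every object is the directed
  colimit of its finite subsets.
\<close>

subsection \<open>Transporting a category along bijections of hom-sets\<close>

text \<open>Composition in \<open>Ind\<close> is a union over representatives, which makes even its
  category laws awkward to check directly. The proof compares hom-sets instead: if every Hom(X i, -)
  preserves the colimit b of Y, and a is the colimit of X, then Hom(a, b) = lim_i Hom(X i, b) =
  lim_i colim_j Hom(X i, Y j). This bijection is explicit and carries the laws of
  \<open>Set_L\<close> over to \<open>Ind\<close>. Labels are delicate because arrows shrink them.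
  The legs force the label of a colimit point below the labels of all its representatives, and
  universality makes it the largest such set, their intersection. Were the intersection not
  attained, a one-point object with that label would map to the colimit without factoring through
  any stage. Size is the third issue: the universe provides subsets and images inside the type
  \<open>'u\<close>, so pairs and finite subsets have to be coded there by cardinality
  estimates.\<close>

text \<open>\<open>C\<close> is not assumed to be a category: its laws are those of \<open>D\<close>, transported along \<open>T\<close>.\<close>

lemma equivalent_categoriesI:
  fixes C :: "('o, 'm) cat" and D :: "('p, 'n) cat"
  assumes D: "category D"
    and Fo: "\<And>a. a \<in> Obj C \<Longrightarrow> Fo a \<in> Obj D"
    and bij: "\<And>a b. \<lbrakk>a \<in> Obj C; b \<in> Obj C\<rbrakk> \<Longrightarrow> bij_betw (T a b) (Hom D (Fo a) (Fo b)) (Hom C a b)"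
    and T_Ident: "\<And>a. a \<in> Obj C \<Longrightarrow> T a a (Ident D (Fo a)) = Ident C a"
    and T_Comp: "\<And>a b c f g. \<lbrakk>a \<in> Obj C; b \<in> Obj C; c \<in> Obj C;
        f \<in> Hom D (Fo a) (Fo b); g \<in> Hom D (Fo b) (Fo c)\<rbrakk> \<Longrightarrow>
        T a c (Comp D (Fo a) (Fo b) (Fo c) g f) = Comp C a b c (T b c g) (T a b f)"
    and surj: "\<And>d. d \<in> Obj D \<Longrightarrow> \<exists>a \<in> Obj C. \<exists>f. is_iso D (Fo a) d f"
  shows "equivalent_categories C D"
proof -
  interpret D: category D by (fact D)
  define R where "R a b = inv_into (Hom D (Fo a) (Fo b)) (T a b)" for a b
  have T_Hom: "T a b h \<in> Hom C a b"
    if "a \<in> Obj C" "b \<in> Obj C" "h \<in> Hom D (Fo a) (Fo b)" for a b h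
    using bij_betwE[OF bij] that by blast
  have R_Hom: "R a b f \<in> Hom D (Fo a) (Fo b)" and T_R: "T a b (R a b f) = f"
    if "a \<in> Obj C" "b \<in> Obj C" "f \<in> Hom C a b" for a b f
    using bij[OF that(1,2)] that(3) unfolding R_def bij_betw_def
    by (auto intro: inv_into_into f_inv_into_f)
  have R_T: "R a b (T a b h) = h"
    if "a \<in> Obj C" "b \<in> Obj C" "h \<in> Hom D (Fo a) (Fo b)" for a b h
    using bij[OF that(1,2)] that(3) unfolding R_def bij_betw_def by auto
  note [simp] = D.Comp_in_Hom D.Ident_in_Hom D.Comp_Ident_left D.Comp_Ident_right Fo T_Hom R_Hom
    T_R R_T

  \<comment> \<open>Read from right to left, \<open>T_Comp\<close> expresses composites of
    \<open>C\<close> through those of \<open>D\<close>; associativity in \<open>C\<close> is then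
    associativity in \<open>D\<close>.\<close>
  have Comp_T: "Comp C a b c g f = T a c (Comp D (Fo a) (Fo b) (Fo c) (R b c g) (R a b f))"
    if "a \<in> Obj C" "b \<in> Obj C" "c \<in> Obj C" "f \<in> Hom C a b" "g \<in> Hom C b c" for a b c f g
    using that T_Comp[of a b c "R a b f" "R b c g"] by simp
  have C: "category C"
  proof
    fix a assume "a \<in> Obj C"
    then show "Ident C a \<in> Hom C a a" by (simp flip: T_Ident)
  next
    fix a b c f g
    assume "a \<in> Obj C" "b \<in> Obj C" "c \<in> Obj C" "f \<in> Hom C a b" "g \<in> Hom C b c"
    then show "Comp C a b c g f \<in> Hom C a c" by (simp add: Comp_T)
  next
    fix a b f assume *: "a \<in> Obj C" "b \<in> Obj C" "f \<in> Hom C a b"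
    then show "Comp C a b b (Ident C b) f = f"
      using T_Comp[of a b b "R a b f" "Ident D (Fo b)"] by (simp add: T_Ident)
    show "Comp C a a b f (Ident C a) = f"
      using * T_Comp[of a a b "Ident D (Fo a)" "R a b f"] by (simp add: T_Ident)
  next
    fix a b c d f g h
    assume "a \<in> Obj C" "b \<in> Obj C" "c \<in> Obj C" "d \<in> Obj C"
      "f \<in> Hom C a b" "g \<in> Hom C b c" "h \<in> Hom C c d"
    then show "Comp C a b d (Comp C b c d h g) f = Comp C a c d h (Comp C a b c g f)"
      by (simp add: Comp_T D.Comp_assoc)
  qed

  have "\<forall>d. \<exists>a e e'. d \<in> Obj D \<longrightarrow> a \<in> Obj C \<and> e \<in> Hom D (Fo a) d \<and> e' \<in> Hom D d (Fo a) \<and>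
      Comp D (Fo a) d (Fo a) e' e = Ident D (Fo a) \<and> Comp D d (Fo a) d e e' = Ident D d"
    using surj unfolding is_iso_def by blast
  then obtain a e e' where
    a [simp]: "\<And>d. d \<in> Obj D \<Longrightarrow> a d \<in> Obj C" and
    e [simp]: "\<And>d. d \<in> Obj D \<Longrightarrow> e d \<in> Hom D (Fo (a d)) d" and
    e' [simp]: "\<And>d. d \<in> Obj D \<Longrightarrow> e' d \<in> Hom D d (Fo (a d))" and
    e'_e [simp]: "\<And>d. d \<in> Obj D \<Longrightarrow> Comp D (Fo (a d)) d (Fo (a d)) (e' d) (e d) = Ident D (Fo (a d))" and
    e_e' [simp]: "\<And>d. d \<in> Obj D \<Longrightarrow> Comp D d (Fo (a d)) d (e d) (e' d) = Ident D d"
    by metis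
  \<comment> \<open>\<open>e d\<close> is split mono, so arrows into \<open>Fo (a d)\<close> may be
    compared after composing with \<open>e d\<close>. The functor laws of \<open>G\<close> are
    checked this way.\<close>
  have e_mono: "x = y"
    if "b \<in> Obj D" "d \<in> Obj D" "x \<in> Hom D b (Fo (a d))" "y \<in> Hom D b (Fo (a d))"
      "Comp D b (Fo (a d)) d (e d) x = Comp D b (Fo (a d)) d (e d) y" for b d x y
  proof -
    have "z = Comp D b d (Fo (a d)) (e' d) (Comp D b (Fo (a d)) d (e d) z)"
      if "z \<in> Hom D b (Fo (a d))" for z
      using that \<open>b \<in> Obj D\<close> \<open>d \<in> Obj D\<close>
        D.Comp_assoc[of b "Fo (a d)" d "Fo (a d)" z "e d" "e' d"] by simp
    then show ?thesis using that by metis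
  qed
  have e_iso: "is_iso D (Fo (a d)) d (e d)" if "d \<in> Obj D" for d
    unfolding is_iso_def using that by (auto intro: bexI[of _ "e' d"])
  \<comment> \<open>Conjugation by the chosen isomorphisms. The square \<open>e_t\<close> determines
    \<open>t d d' h\<close> because \<open>e d'\<close> is mono, and it is also the naturality of
    \<open>e\<close>.\<close>
  define t where "t d d' h = Comp D (Fo (a d)) d' (Fo (a d')) (e' d') (Comp D (Fo (a d)) d d' h (e d))"
    for d d' h
  have t [simp]: "t d d' h \<in> Hom D (Fo (a d)) (Fo (a d'))"
    and e_t: "Comp D (Fo (a d)) (Fo (a d')) d' (e d') (t d d' h) = Comp D (Fo (a d)) d d' h (e d)"
    if "d \<in> Obj D" "d' \<in> Obj D" "h \<in> Hom D d d'" for d d' h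
    using that D.Comp_assoc[of "Fo (a d)" d' "Fo (a d')" d' "Comp D (Fo (a d)) d d' h (e d)" "e' d'" "e d'"]
    unfolding t_def by simp_all
  define F where "F = \<lparr>on_obj = Fo, on_arr = R\<rparr>"
  define G where "G = \<lparr>on_obj = a, on_arr = \<lambda>d d' h. T (a d) (a d') (t d d' h)\<rparr>"

  have "is_functor C D F"
    unfolding F_def by standard (simp_all flip: T_Ident add: Comp_T)
  moreover have "is_functor D C G"
  proof
    fix d assume d: "d \<in> Obj D"
    have "t d d (Ident D d) = Ident D (Fo (a d))"
      by (rule e_mono[of "Fo (a d)" d]) (simp_all add: d e_t)
    then show "on_arr G d d (Ident D d) = Ident C (on_obj G d)"
      using d by (simp add: G_def T_Ident)
  next
    fix b c d f g assume *: "b \<in> Obj D" "c \<in> Obj D" "d \<in> Obj D" "f \<in> Hom D b c" "g \<in> Hom D c d"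
    have "t b d (Comp D b c d g f) = Comp D (Fo (a b)) (Fo (a c)) (Fo (a d)) (t c d g) (t b c f)"
    proof (rule e_mono)
      have "Comp D (Fo (a b)) (Fo (a d)) d (e d)
            (Comp D (Fo (a b)) (Fo (a c)) (Fo (a d)) (t c d g) (t b c f)) =
          Comp D (Fo (a b)) (Fo (a c)) d (Comp D (Fo (a c)) c d g (e c)) (t b c f)"
        using * by (simp add: e_t flip: D.Comp_assoc)
      also have "\<dots> = Comp D (Fo (a b)) b d (Comp D b c d g f) (e b)"
        using * by (simp add: e_t D.Comp_assoc)
      finally show "Comp D (Fo (a b)) (Fo (a d)) d (e d) (t b d (Comp D b c d g f)) =
          Comp D (Fo (a b)) (Fo (a d)) d (e d)
            (Comp D (Fo (a b)) (Fo (a c)) (Fo (a d)) (t c d g) (t b c f))"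
        using * by (simp add: e_t)
    qed (use * in simp_all)
    then show "on_arr G b d (Comp D b c d g f) =
        Comp C (on_obj G b) (on_obj G c) (on_obj G d) (on_arr G c d g) (on_arr G b c f)"
      using * by (simp add: G_def T_Comp)
  qed (simp_all add: G_def)
  moreover have "naturally_isomorphic C C (comp_functor G F) id_functor"
    unfolding naturally_isomorphic_def
  \<comment> \<open>The isomorphism \<open>e (Fo b)\<close> from \<open>Fo (a (Fo b))\<close> to
    \<open>Fo b\<close> lives in \<open>D\<close>; \<open>T\<close> lifts it and its inverse to
    \<open>C\<close>.\<close>
  proof (intro exI[of _ "\<lambda>b. T (a (Fo b)) b (e (Fo b))"] conjI ballI)
    fix b assume b: "b \<in> Obj C"
    show "is_iso C (on_obj (comp_functor G F) b) (on_obj id_functor b) (T (a (Fo b)) b (e (Fo b)))"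
      unfolding is_iso_def
      using b by (auto simp: comp_functor_def id_functor_def F_def G_def T_Ident
          simp flip: T_Comp intro!: bexI[of _ "T b (a (Fo b)) (e' (Fo b))"])
  next
    fix b c f assume *: "b \<in> Obj C" "c \<in> Obj C" "f \<in> Hom C b c"
    then have "Comp C b b c f (T b b (Ident D (Fo b))) = f"
      by (simp add: T_Ident category.Comp_Ident_right[OF C])
    with * show "Comp C (on_obj (comp_functor G F) b) (on_obj (comp_functor G F) c)
          (on_obj id_functor c) (T (a (Fo c)) c (e (Fo c))) (on_arr (comp_functor G F) b c f) =
        Comp C (on_obj (comp_functor G F) b) (on_obj id_functor b) (on_obj id_functor c)
          (on_arr id_functor b c f) (T (a (Fo b)) b (e (Fo b)))"
      by (simp add: comp_functor_def id_functor_def F_def G_def Comp_T e_t)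
  qed
  moreover have "naturally_isomorphic D D (comp_functor F G) id_functor"
    unfolding naturally_isomorphic_def
    by (rule exI[of _ e]) (simp add: comp_functor_def id_functor_def F_def G_def e_t e_iso)
  ultimately show ?thesis
    unfolding equivalent_categories_def using C D by blast
qed

subsection \<open>Colimits seen by finitely presentable objects\<close>

lemma full_subcategory_simps [simp]:
  "Obj (full_subcategory C P) = {a \<in> Obj C. P a}"
  "Hom (full_subcategory C P) = Hom C"
  "Ident (full_subcategory C P) = Ident C"
  "Comp (full_subcategory C P) = Comp C"
  by (simp_all add: full_subcategory_def)

text \<open>The last two assumptions say that \<open>Hom(c, -)\<close> preserves the colimit if \<open>P c\<close>, i.e. that \<open>c\<close>
  is finitely presentable relative to this diagram.\<close>

locale ind_colimit = category D for D :: "('o, 'm) cat" +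
  fixes P :: "'o \<Rightarrow> bool"
    and J :: "('u, 'u) cat" and Y :: "('u, 'u, 'o, 'm) func"
    and d :: 'o and \<kappa> :: "'u \<Rightarrow> 'm"
  assumes diagram: "is_functor J (full_subcategory D P) Y"
    and apex: "d \<in> Obj D"
    and leg: "j \<in> Obj J \<Longrightarrow> \<kappa> j \<in> Hom D (on_obj Y j) d"
    and leg_natural: "\<lbrakk>j \<in> Obj J; j' \<in> Obj J; u \<in> Hom J j j'\<rbrakk> \<Longrightarrow>
      Comp D (on_obj Y j) (on_obj Y j') d (\<kappa> j') (on_arr Y j j' u) = \<kappa> j"
    and jointly_epic: "\<lbrakk>e \<in> Obj D; h \<in> Hom D d e; h' \<in> Hom D d e;
      \<And>j. j \<in> Obj J \<Longrightarrow> Comp D (on_obj Y j) d e h (\<kappa> j) = Comp D (on_obj Y j) d e h' (\<kappa> j)\<rbrakk> \<Longrightarrow>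
      h = h'"
    and factor_cocone: "\<lbrakk>e \<in> Obj D; \<And>j. j \<in> Obj J \<Longrightarrow> l j \<in> Hom D (on_obj Y j) e;
      \<And>j j' u. \<lbrakk>j \<in> Obj J; j' \<in> Obj J; u \<in> Hom J j j'\<rbrakk> \<Longrightarrow>
        Comp D (on_obj Y j) (on_obj Y j') e (l j') (on_arr Y j j' u) = l j\<rbrakk> \<Longrightarrow>
      \<exists>h \<in> Hom D d e. \<forall>j \<in> Obj J. Comp D (on_obj Y j) d e h (\<kappa> j) = l j"
    and factor_through_leg: "\<lbrakk>c \<in> Obj D; P c; m \<in> Hom D c d\<rbrakk> \<Longrightarrow>
      \<exists>j \<in> Obj J. \<exists>f \<in> Hom D c (on_obj Y j). Comp D c (on_obj Y j) d (\<kappa> j) f = m"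
    and equal_later: "\<lbrakk>c \<in> Obj D; P c; j \<in> Obj J; j' \<in> Obj J;
        f \<in> Hom D c (on_obj Y j); f' \<in> Hom D c (on_obj Y j');
        Comp D c (on_obj Y j) d (\<kappa> j) f = Comp D c (on_obj Y j') d (\<kappa> j') f'\<rbrakk> \<Longrightarrow>
      \<exists>k \<in> Obj J. \<exists>p \<in> Hom J j k. \<exists>q \<in> Hom J j' k.
        Comp D c (on_obj Y j) (on_obj Y k) (on_arr Y j k p) f =
        Comp D c (on_obj Y j') (on_obj Y k) (on_arr Y j' k q) f'"
begin

lemma diagram_obj [simp]: "j \<in> Obj J \<Longrightarrow> on_obj Y j \<in> Obj D" "j \<in> Obj J \<Longrightarrow> P (on_obj Y j)"
  using is_functor.on_obj_in_Obj[OF diagram] by auto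

lemma diagram_arr [simp]:
  "\<lbrakk>j \<in> Obj J; j' \<in> Obj J; u \<in> Hom J j j'\<rbrakk> \<Longrightarrow>
    on_arr Y j j' u \<in> Hom D (on_obj Y j) (on_obj Y j')"
  using is_functor.on_arr_in_Hom[OF diagram] by auto

lemmas [simp] = Comp_in_Hom Ident_in_Hom Comp_Ident_left Comp_Ident_right apex leg leg_natural

text \<open>The set of factorizations of \<open>m : c \<rightarrow> d\<close> through the legs; for \<open>P c\<close> these sets are
  precisely the elements of \<open>colim_hom\<close>.\<close>

definition fibre :: "'o \<Rightarrow> 'm \<Rightarrow> ('u \<times> 'm) set" where
  "fibre c m = {(j, f). j \<in> Obj J \<and> f \<in> Hom D c (on_obj Y j) \<and>
     Comp D c (on_obj Y j) d (\<kappa> j) f = m}"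

lemma fibre_nonempty:
  assumes "c \<in> Obj D" "P c" "m \<in> Hom D c d"
  obtains j f where "(j, f) \<in> fibre c m"
  using factor_through_leg[OF assms] by (auto simp: fibre_def)

text \<open>Composing any factorization with its leg gives the arrow back, and the fibre of
  \<open>m\<close> has an element.\<close>

lemma fibre_inject:
  assumes "c \<in> Obj D" "P c" "m \<in> Hom D c d" "fibre c m = fibre c m'"
  shows "m = m'"
proof -
  obtain j f where "(j, f) \<in> fibre c m" using fibre_nonempty[OF assms(1-3)] .
  moreover from this have "(j, f) \<in> fibre c m'" using assms(4) by simp
  ultimately show ?thesis unfolding fibre_def by auto
qed

text \<open>Germs that agree at a later stage have the same composite into \<open>d\<close> by
  naturality of the legs; \<open>equal_later\<close> is the converse. Questions about
  \<open>germ_rel\<close> thereby become equations between arrows into \<open>d\<close>.\<close>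

lemma germ_class_eq_fibre:
  assumes c: "c \<in> Obj D" "P c" and jf: "(j, f) \<in> fibre c m"
  shows "germ_class (full_subcategory D P) c (J, Y) (j, f) = fibre c m"
proof -
  have j: "j \<in> Obj J" "f \<in> Hom D c (on_obj Y j)" "Comp D c (on_obj Y j) d (\<kappa> j) f = m"
    using jf by (auto simp: fibre_def)
  have "Comp D c (on_obj Y j') d (\<kappa> j') f' = m"
    if "j' \<in> Obj J" "f' \<in> Hom D c (on_obj Y j')" "k \<in> Obj J" "p \<in> Hom J j k" "q \<in> Hom J j' k"
      "Comp D c (on_obj Y j) (on_obj Y k) (on_arr Y j k p) f =
       Comp D c (on_obj Y j') (on_obj Y k) (on_arr Y j' k q) f'" for j' f' k p q
    using that c j Comp_assoc[of c "on_obj Y j" "on_obj Y k" d f "on_arr Y j k p" "\<kappa> k"]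
      Comp_assoc[of c "on_obj Y j'" "on_obj Y k" d f' "on_arr Y j' k q" "\<kappa> k"] by simp
  moreover have "\<exists>k \<in> Obj J. \<exists>p \<in> Hom J j k. \<exists>q \<in> Hom J j' k.
      Comp D c (on_obj Y j) (on_obj Y k) (on_arr Y j k p) f =
      Comp D c (on_obj Y j') (on_obj Y k) (on_arr Y j' k q) f'"
    if "(j', f') \<in> fibre c m" for j' f'
    using that j by (intro equal_later[OF c]) (auto simp: fibre_def)
  moreover have "(j', f') \<in> germ_class (full_subcategory D P) c (J, Y) (j, f) \<longleftrightarrow>
      j' \<in> Obj J \<and> f' \<in> Hom D c (on_obj Y j') \<and>
      (\<exists>k \<in> Obj J. \<exists>p \<in> Hom J j k. \<exists>q \<in> Hom J j' k.
        Comp D c (on_obj Y j) (on_obj Y k) (on_arr Y j k p) f =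
        Comp D c (on_obj Y j') (on_obj Y k) (on_arr Y j' k q) f')" for j' f'
    using j by (simp add: germ_class_def germ_rel_def germs_def)
  ultimately have "(j', f') \<in> germ_class (full_subcategory D P) c (J, Y) (j, f) \<longleftrightarrow>
      (j', f') \<in> fibre c m" for j' f'
    unfolding fibre_def by blast
  then show ?thesis by auto
qed

text \<open>Finite presentability in the form colim_j Hom(c, Y j) = Hom(c, d):
  \<open>fibre c\<close> inverts the map that composes a germ with its leg.\<close>

lemma colim_hom_eq:
  assumes "c \<in> Obj D" "P c"
  shows "colim_hom (full_subcategory D P) c (J, Y) = fibre c ` Hom D c d"
proof (intro equalityI subsetI)
  fix \<gamma> assume "\<gamma> \<in> colim_hom (full_subcategory D P) c (J, Y)"
  then obtain j f where jf: "j \<in> Obj J" "f \<in> Hom D c (on_obj Y j)"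
    "\<gamma> = germ_class (full_subcategory D P) c (J, Y) (j, f)"
    by (auto simp: colim_hom_def germ_class_def germs_def elim!: quotientE)
  then have "\<gamma> = fibre c (Comp D c (on_obj Y j) d (\<kappa> j) f)"
    using germ_class_eq_fibre[OF assms] by (simp add: fibre_def)
  then show "\<gamma> \<in> fibre c ` Hom D c d" using jf assms by simp
next
  fix \<gamma> assume "\<gamma> \<in> fibre c ` Hom D c d"
  then obtain m where m: "m \<in> Hom D c d" "\<gamma> = fibre c m" by blast
  obtain j f where jf: "(j, f) \<in> fibre c m" using fibre_nonempty[OF assms m(1)] .
  then have "\<gamma> = germ_class (full_subcategory D P) c (J, Y) (j, f)"
    using germ_class_eq_fibre[OF assms] m by simp
  then show "\<gamma> \<in> colim_hom (full_subcategory D P) c (J, Y)"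
    using jf by (auto simp: colim_hom_def germ_class_def germs_def fibre_def intro: quotientI)
qed

text \<open>All representatives contribute the same class and at least one exists, so the union in
  \<open>colim_hom_pre\<close> collapses to that class.\<close>

lemma colim_hom_pre_fibre:
  assumes c: "c \<in> Obj D" "P c" and c': "c' \<in> Obj D" "P c'"
    and u: "u \<in> Hom D c c'" and m: "m \<in> Hom D c' d"
  shows "colim_hom_pre (full_subcategory D P) (J, Y) c c' u (fibre c' m) = fibre c (Comp D c c' d m u)"
proof -
  have "germ_class (full_subcategory D P) c (J, Y) (j, Comp D c c' (on_obj Y j) f u) =
      fibre c (Comp D c c' d m u)" if "(j, f) \<in> fibre c' m" for j f
    using that c c' u
    by (intro germ_class_eq_fibre[OF c]) (auto simp: fibre_def Comp_assoc[symmetric])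
  moreover obtain j f where "(j, f) \<in> fibre c' m" using fibre_nonempty[OF c' m] .
  ultimately show ?thesis by (auto simp: colim_hom_pre_def)
qed

end

text \<open>The apex attached to a diagram will be picked by choice; uniqueness allows it to be
  replaced by any prescribed colimit.\<close>

lemma ind_colimit_unique:
  assumes "ind_colimit D P J Y d \<kappa>" "ind_colimit D P J Y e l"
  shows "\<exists>f. is_iso D d e f"
proof -
  interpret d: ind_colimit D P J Y d \<kappa> by fact
  interpret e: ind_colimit D P J Y e l by fact
  obtain f where f: "f \<in> Hom D d e" "\<forall>j \<in> Obj J. Comp D (on_obj Y j) d e f (\<kappa> j) = l j"
    using d.factor_cocone[of e l] by auto
  obtain g where g: "g \<in> Hom D e d" "\<forall>j \<in> Obj J. Comp D (on_obj Y j) e d g (l j) = \<kappa> j"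
    using e.factor_cocone[of d \<kappa>] by auto
  have "Comp D d e d g f = Ident D d"
    by (rule d.jointly_epic[of d]) (use f g in \<open>simp_all add: d.Comp_assoc\<close>)
  moreover have "Comp D e d e f g = Ident D e"
    by (rule e.jointly_epic[of e]) (use f g in \<open>simp_all add: d.Comp_assoc\<close>)
  ultimately show ?thesis using f g unfolding is_iso_def by blast
qed

section \<open>Arrows of \<open>Ind\<close> as arrows between colimits\<close>

locale ind_colimit_pair =
  X: ind_colimit D P I X a \<kappa> + Y: ind_colimit D P J Y b l for D :: "('o, 'm) cat" and P
    and I :: "('u, 'u) cat" and X a \<kappa> and J :: "('u, 'u) cat" and Y b l
begin

text \<open>The image of \<open>h\<close> under Hom(a, b) = lim_i Hom(X i, b) = lim_i colim_j Hom(X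
  i, Y j): restrict \<open>h\<close> along the legs of \<open>a\<close>, then replace each
  restriction by its class of factorizations.\<close>

definition ind_arr where
  "ind_arr h = (\<lambda>i \<in> Obj I. Y.fibre (on_obj X i) (Comp D (on_obj X i) a b h (\<kappa> i)))"

text \<open>Injectivity holds because the legs of \<open>a\<close> are jointly epic. For
  surjectivity, a compatible family of classes is a cocone from \<open>X\<close> to
  \<open>b\<close>, which factors through \<open>a\<close>.\<close>

lemma bij_betw_ind_arr:
  "bij_betw ind_arr (Hom D a b) (ind_hom (full_subcategory D P) (I, X) (J, Y))"
  unfolding bij_betw_def
proof
  show "inj_on ind_arr (Hom D a b)"
  proof (rule inj_onI)
    fix h h' assume h: "h \<in> Hom D a b" "h' \<in> Hom D a b" "ind_arr h = ind_arr h'"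
    show "h = h'"
    proof (rule X.jointly_epic[of b])
      fix i assume "i \<in> Obj I"
      then show "Comp D (on_obj X i) a b h (\<kappa> i) = Comp D (on_obj X i) a b h' (\<kappa> i)"
        using h(1,2) fun_cong[OF h(3), of i]
        by (intro Y.fibre_inject[of "on_obj X i"]) (simp_all add: ind_arr_def)
    qed (use h in simp_all)
  qed
  show "ind_arr ` Hom D a b = ind_hom (full_subcategory D P) (I, X) (J, Y)"
  proof (intro equalityI subsetI)
    fix \<phi> assume "\<phi> \<in> ind_arr ` Hom D a b"
    then show "\<phi> \<in> ind_hom (full_subcategory D P) (I, X) (J, Y)"
      by (auto simp: ind_hom_def ind_arr_def Y.colim_hom_eq Y.colim_hom_pre_fibre X.Comp_assoc)
  next
    fix \<phi> assume "\<phi> \<in> ind_hom (full_subcategory D P) (I, X) (J, Y)"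
    then have ext: "\<phi> \<in> extensional (Obj I)"
      and fib: "\<And>i. i \<in> Obj I \<Longrightarrow> \<exists>m \<in> Hom D (on_obj X i) b. \<phi> i = Y.fibre (on_obj X i) m"
      and compat: "\<And>i i' u. \<lbrakk>i \<in> Obj I; i' \<in> Obj I; u \<in> Hom I i i'\<rbrakk> \<Longrightarrow>
        colim_hom_pre (full_subcategory D P) (J, Y) (on_obj X i) (on_obj X i')
          (on_arr X i i' u) (\<phi> i') = \<phi> i"
      by (auto simp: ind_hom_def PiE_iff Y.colim_hom_eq image_iff)
    obtain m where m: "\<And>i. i \<in> Obj I \<Longrightarrow> m i \<in> Hom D (on_obj X i) b"
      "\<And>i. i \<in> Obj I \<Longrightarrow> \<phi> i = Y.fibre (on_obj X i) (m i)"
      using fib by metis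
    \<comment> \<open>Compatibility is an equality of fibres; \<open>fibre_inject\<close> turns it
      into the cocone condition for \<open>m\<close>.\<close>
    have "Comp D (on_obj X i) (on_obj X i') b (m i') (on_arr X i i' u) = m i"
      if "i \<in> Obj I" "i' \<in> Obj I" "u \<in> Hom I i i'" for i i' u
      using compat[OF that] that m
      by (intro Y.fibre_inject[of "on_obj X i"]) (simp_all add: Y.colim_hom_pre_fibre)
    then obtain h where "h \<in> Hom D a b" "\<And>i. i \<in> Obj I \<Longrightarrow> Comp D (on_obj X i) a b h (\<kappa> i) = m i"
      using X.factor_cocone[of b m] m by auto
    moreover from this have "\<phi> = ind_arr h"
      using ext m by (auto simp: ind_arr_def fun_eq_iff extensional_def)
    ultimately show "\<phi> \<in> ind_arr ` Hom D a b" by blast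
  qed
qed

end

text \<open>The identity at stage \<open>j\<close> is a factorization of the leg
  \<open>\<kappa> j\<close>, and that leg is the restriction of \<open>Ident D d\<close> to the
  stage.\<close>

lemma (in ind_colimit) ind_arr_Ident:
  "ind_colimit_pair.ind_arr D J Y d \<kappa> J Y d \<kappa> (Ident D d) = Ident (Ind U (full_subcategory D P)) (J, Y)"
proof -
  interpret ind_colimit_pair D P J Y d \<kappa> J Y d \<kappa> by unfold_locales
  have "germ_class (full_subcategory D P) (on_obj Y j) (J, Y) (j, Ident D (on_obj Y j)) =
      fibre (on_obj Y j) (\<kappa> j)" if "j \<in> Obj J" for j
    using that by (intro germ_class_eq_fibre) (simp_all add: fibre_def)
  then show ?thesis
    by (simp add: Ind_def ind_arr_def cong: restrict_cong)
qed

lemma ind_arr_Comp: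
  assumes "ind_colimit D P I X a \<kappa>" "ind_colimit D P J Y b l" "ind_colimit D P K Z c n"
    and g: "g \<in> Hom D a b" and h: "h \<in> Hom D b c"
  shows "ind_colimit_pair.ind_arr D I X a \<kappa> K Z c n (Comp D a b c h g) =
    Comp (Ind U (full_subcategory D P)) (I, X) (J, Y) (K, Z)
      (ind_colimit_pair.ind_arr D J Y b l K Z c n h) (ind_colimit_pair.ind_arr D I X a \<kappa> J Y b l g)"
proof -
  interpret X: ind_colimit D P I X a \<kappa> by fact
  interpret Y: ind_colimit D P J Y b l by fact
  interpret Z: ind_colimit D P K Z c n by fact
  interpret XY: ind_colimit_pair D P I X a \<kappa> J Y b l by unfold_locales
  interpret YZ: ind_colimit_pair D P J Y b l K Z c n by unfold_locales
  interpret XZ: ind_colimit_pair D P I X a \<kappa> K Z c n by unfold_locales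
  have "Z.fibre (on_obj X i) (Comp D (on_obj X i) a c (Comp D a b c h g) (\<kappa> i)) =
      (\<Union>(j, f) \<in> XY.ind_arr g i. \<Union>(k, f') \<in> YZ.ind_arr h j.
         germ_class (full_subcategory D P) (on_obj X i) (K, Z)
           (k, Comp D (on_obj X i) (on_obj Y j) (on_obj Z k) f' f))" (is "?F = ?U")
    if i: "i \<in> Obj I" for i
  proof -
    \<comment> \<open>If \<open>f\<close> represents \<open>g\<close> on stage \<open>i\<close> and
      \<open>f'\<close> represents \<open>h\<close> on stage \<open>j\<close>, then
      \<open>n k\<close> after \<open>f'\<close> after \<open>f\<close> equals \<open>h\<close>
      after \<open>l j\<close> after \<open>f\<close>, hence \<open>h\<close> after \<open>g\<close>
      after \<open>\<kappa> i\<close>.\<close>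
    have germ: "germ_class (full_subcategory D P) (on_obj X i) (K, Z)
        (k, Comp D (on_obj X i) (on_obj Y j) (on_obj Z k) f' f) = ?F"
      if "(j, f) \<in> XY.ind_arr g i" "(k, f') \<in> YZ.ind_arr h j" for j f k f'
    proof (rule Z.germ_class_eq_fibre)
      have j: "j \<in> Obj J" "f \<in> Hom D (on_obj X i) (on_obj Y j)"
        "Comp D (on_obj X i) (on_obj Y j) b (l j) f = Comp D (on_obj X i) a b g (\<kappa> i)"
        using that(1) i by (auto simp: XY.ind_arr_def Y.fibre_def)
      then have k: "k \<in> Obj K" "f' \<in> Hom D (on_obj Y j) (on_obj Z k)"
        "Comp D (on_obj Y j) (on_obj Z k) c (n k) f' = Comp D (on_obj Y j) b c h (l j)"
        using that(2) by (auto simp: YZ.ind_arr_def Z.fibre_def)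
      have "Comp D (on_obj X i) (on_obj Z k) c (n k)
          (Comp D (on_obj X i) (on_obj Y j) (on_obj Z k) f' f) =
        Comp D (on_obj X i) (on_obj Y j) c (Comp D (on_obj Y j) b c h (l j)) f"
        using i j(1,2) k(1,2) by (simp flip: X.Comp_assoc k(3))
      also have "\<dots> = Comp D (on_obj X i) a c (Comp D a b c h g) (\<kappa> i)"
        using i j g h by (simp add: X.Comp_assoc)
      finally show "(k, Comp D (on_obj X i) (on_obj Y j) (on_obj Z k) f' f) \<in> ?F"
        using i j k by (simp add: Z.fibre_def)
    qed (use i in simp_all)
    \<comment> \<open>Both index sets are inhabited, so the union of equal classes is that class and
      not the empty set.\<close>
    obtain j f where jf: "(j, f) \<in> XY.ind_arr g i"
      using Y.fibre_nonempty[of "on_obj X i" "Comp D (on_obj X i) a b g (\<kappa> i)"] i g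
      by (auto simp: XY.ind_arr_def)
    then have j: "j \<in> Obj J" using i by (auto simp: XY.ind_arr_def Y.fibre_def)
    obtain k f' where kf: "(k, f') \<in> YZ.ind_arr h j"
      using Z.fibre_nonempty[of "on_obj Y j" "Comp D (on_obj Y j) b c h (l j)"] j h
      by (auto simp: YZ.ind_arr_def)
    show ?thesis
    proof
      show "?F \<subseteq> ?U" using germ[OF jf kf] jf kf by blast
      show "?U \<subseteq> ?F" using germ by blast
    qed
  qed
  then show ?thesis by (auto simp: Ind_def XZ.ind_arr_def intro!: restrict_ext)
qed

text \<open>Recognition principle for Ind-completions: preservation of the colimits by Hom(c, -),
  which is part of \<open>ind_colimit\<close>, makes taking colimits full and faithful, and
  \<open>dense\<close> makes it essentially surjective.\<close>

theorem Ind_full_subcategory_equivalent: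
  fixes D :: "('o, 'm) cat" and U :: "'u set set"
  assumes D: "category D"
    and colim: "\<And>J Y. (J, Y) \<in> filtered_diagrams U (full_subcategory D P) \<Longrightarrow> \<exists>d \<kappa>. ind_colimit D P J Y d \<kappa>"
    and dense: "\<And>d. d \<in> Obj D \<Longrightarrow>
      \<exists>J Y \<kappa>. (J, Y) \<in> filtered_diagrams U (full_subcategory D P) \<and> ind_colimit D P J Y d \<kappa>"
  shows "equivalent_categories (Ind U (full_subcategory D P)) D"
proof -
  let ?C = "Ind U (full_subcategory D P)"
  have Obj: "Obj ?C = filtered_diagrams U (full_subcategory D P)"
    and Hom: "Hom ?C = ind_hom (full_subcategory D P)"
    by (simp_all add: Ind_def)
  have "\<exists>d \<kappa>. A \<in> Obj ?C \<longrightarrow> ind_colimit D P (fst A) (snd A) d \<kappa>" for A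
    using colim[of "fst A" "snd A"] by (auto simp: Obj)
  then obtain d \<kappa> where *: "\<And>A. A \<in> Obj ?C \<Longrightarrow> ind_colimit D P (fst A) (snd A) (d A) (\<kappa> A)"
    by metis
  define T where "T A B = ind_colimit_pair.ind_arr D (fst A) (snd A) (d A) (\<kappa> A) (fst B) (snd B) (d B) (\<kappa> B)"
    for A B
  show ?thesis
  proof (rule equivalent_categoriesI[where Fo = d and T = T, OF D])
    fix A assume "A \<in> Obj ?C"
    then interpret A: ind_colimit D P "fst A" "snd A" "d A" "\<kappa> A" by (rule *)
    show "d A \<in> Obj D" by (rule A.apex)
    show "T A A (Ident D (d A)) = Ident ?C A"
      unfolding T_def A.ind_arr_Ident[of U] by simp
  next
    fix A B assume "A \<in> Obj ?C" "B \<in> Obj ?C"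
    then interpret ind_colimit_pair D P "fst A" "snd A" "d A" "\<kappa> A" "fst B" "snd B" "d B" "\<kappa> B"
      by (intro ind_colimit_pair.intro *)
    show "bij_betw (T A B) (Hom D (d A) (d B)) (Hom ?C A B)"
      using bij_betw_ind_arr by (simp add: T_def Hom)
  next
    fix A B E f g
    assume "A \<in> Obj ?C" "B \<in> Obj ?C" "E \<in> Obj ?C" "f \<in> Hom D (d A) (d B)" "g \<in> Hom D (d B) (d E)"
    then show "T A E (Comp D (d A) (d B) (d E) g f) = Comp ?C A B E (T B E g) (T A B f)"
      using ind_arr_Comp[OF * * *, of A B E f g U] by (simp add: T_def)
  next
    fix e assume "e \<in> Obj D"
    then obtain J Y \<kappa>' where J: "(J, Y) \<in> Obj ?C" "ind_colimit D P J Y e \<kappa>'"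
      using dense unfolding Obj by blast
    then show "\<exists>A \<in> Obj ?C. \<exists>f. is_iso D (d A) e f"
      using ind_colimit_unique[OF _ J(2)] * by fastforce
  qed
qed

subsection \<open>Small sets\<close>

text \<open>For each size, induction on the size bounds the number of subsets by |A|; a countable
  union of such families stays below |A|.\<close>

lemma Fpow_ordLeq:
  includes cardinal_syntax
  assumes "infinite A"
  shows "|Fpow A| \<le>o |A|"
proof -
  have *: "|{S. S \<subseteq> A \<and> card S = n \<and> finite S}| \<le>o |A|" for n
  proof (induction n)
    case 0
    have "{S. S \<subseteq> A \<and> card S = 0 \<and> finite S} = {{}}" by auto
    then show ?case using assms card_of_singl_ordLeq[of A "{}"] by auto
  next
    case (Suc n)
    let ?F = "\<lambda>n. {S. S \<subseteq> A \<and> card S = n \<and> finite S}"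
    have "?F (Suc n) \<subseteq> (\<lambda>(x, S). insert x S) ` (SIGMA x : A. ?F n)"
    proof
      fix S assume "S \<in> ?F (Suc n)"
      then obtain x T where "S = insert x T" "x \<notin> T" "card T = n" "finite T" "S \<subseteq> A"
        by (auto simp: card_Suc_eq)
      then show "S \<in> (\<lambda>(x, S). insert x S) ` (SIGMA x : A. ?F n)" by force
    qed
    then have "|?F (Suc n)| \<le>o |SIGMA x : A. ?F n|"
      by (meson card_of_image card_of_mono1 ordLeq_transitive)
    also have "|SIGMA x : A. ?F n| \<le>o |A|"
      using assms Suc by (intro card_of_Sigma_ordLeq_infinite) (simp_all add: card_of_mono1)
    finally show ?case .
  qed
  have "Fpow A = (\<Union>n. {S. S \<subseteq> A \<and> card S = n \<and> finite S})"
    by (auto simp: Fpow_def)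
  also have "|\<dots>| \<le>o |A|"
    using assms * by (intro card_of_UNION_ordLeq_infinite) (auto simp: infinite_iff_card_of_nat)
  finally show ?thesis .
qed

lemma set_universeD:
  assumes "set_universe U"
  shows "\<lbrakk>A \<in> U; B \<subseteq> A\<rbrakk> \<Longrightarrow> B \<in> U" and "A \<in> U \<Longrightarrow> g ` A \<in> U" and "\<exists>A \<in> U. infinite A"
  using assms by (simp_all add: set_universe_def)

text \<open>Index categories and carriers must consist of elements of \<open>'u\<close>. A set of
  another type is coded by embedding it in a member of the universe and taking the image, a subset
  of that member.\<close>

lemma universe_encoding:
  includes cardinal_syntax
  fixes A :: "'u set"
  assumes "set_universe U" "A \<in> U" "|S| \<le>o |A|"
  obtains e :: "'s \<Rightarrow> 'u" where "inj_on e S" "e ` S \<in> U"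
proof -
  obtain e where "inj_on e S" "e ` S \<subseteq> A"
    using assms(3) by (auto simp flip: card_of_ordLeq)
  then show ?thesis using set_universeD(1)[OF assms(1,2)] that by blast
qed

lemma finite_ordLeq_infinite:
  includes cardinal_syntax
  assumes "finite A" "infinite B"
  shows "|A| \<le>o |B|"
  using ordLeq_total[OF card_of_Well_order card_of_Well_order, of A B] card_of_ordLeq_finite[of B A]
    assms by blast

text \<open>The cardinal estimates need an infinite bound; a finite \<open>A\<close> is bounded by
  the infinite member of the universe.\<close>

lemma infinite_ordLeq_universe:
  includes cardinal_syntax
  assumes "set_universe U" "A \<in> U"
  obtains B where "B \<in> U" "infinite B" "|A| \<le>o |B|"
proof (cases "finite A")
  case True
  obtain B where "B \<in> U" "infinite B" using set_universeD(3)[OF assms(1)] by blast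
  then show ?thesis using that[of B] True by (simp add: finite_ordLeq_infinite)
next
  case False
  then show ?thesis using that[OF assms(2) _ card_of_mono1[OF subset_refl]] by blast
qed

text \<open>The codes serve as objects of the index category of finite subsets.\<close>

lemma Fpow_universe_encoding:
  fixes X :: "'u set"
  assumes "set_universe U" "X \<in> U"
  obtains e :: "'u set \<Rightarrow> 'u" where "inj_on e (Fpow X)" "e ` Fpow X \<in> U"
proof -
  include cardinal_syntax
  obtain B where B: "B \<in> U" "infinite B" "|X| \<le>o |B|"
    using infinite_ordLeq_universe[OF assms] .
  then obtain f where f: "inj_on f X" "f ` X \<subseteq> B" by (auto simp flip: card_of_ordLeq)
  have "|Fpow X| \<le>o |Fpow B|"
    using inj_on_image_Fpow[OF f(1)] image_Fpow_mono[OF f(2)] by (auto simp flip: card_of_ordLeq)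
  then have "|Fpow X| \<le>o |B|"
    using Fpow_ordLeq[OF B(2)] ordLeq_transitive by blast
  then show ?thesis using universe_encoding[OF assms(1) B(1)] that by blast
qed

text \<open>The codes of pairs (stage, point) supply the points of a filtered colimit.\<close>

lemma Sigma_universe_encoding:
  fixes I :: "'u set" and X :: "'u \<Rightarrow> 'x set"
  assumes "set_universe U" "I \<in> U" and fin: "\<And>i. i \<in> I \<Longrightarrow> finite (X i)"
  obtains e :: "'u \<times> 'x \<Rightarrow> 'u" where "inj_on e (Sigma I X)" "e ` Sigma I X \<in> U"
proof -
  include cardinal_syntax
  obtain B where B: "B \<in> U" "infinite B" "|I| \<le>o |B|"
    using infinite_ordLeq_universe[OF assms(1,2)] .
  have "|Sigma I X| \<le>o |B|"
    using B fin by (intro card_of_Sigma_ordLeq_infinite) (simp_all add: finite_ordLeq_infinite)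
  then show ?thesis using universe_encoding[OF assms(1) B(1)] that by blast
qed

lemma singleton_in_universe:
  assumes "set_universe U"
  shows "{x} \<in> U"
proof -
  obtain A where "A \<in> U" "A \<noteq> {}" using set_universeD(3)[OF assms] by force
  then show ?thesis using set_universeD(2)[OF assms, of A "\<lambda>_. x"] by (simp add: image_constant_conv)
qed

subsection \<open>Filtered colimits of finite sets with labels\<close>

text \<open>Projections replace the pattern matching of \<open>Set_L\<close>, so that the equations
  also rewrite at objects that are not displayed as pairs.\<close>

lemma Set_L_simps:
  "Obj (Set_L U L) = {a. fst a \<in> U \<and> snd a \<in> fst a \<rightarrow>\<^sub>E subalgebras L}"
  "Hom (Set_L U L) a b = {m \<in> fst a \<rightarrow>\<^sub>E fst b. \<forall>x \<in> fst a. snd b (m x) \<subseteq> snd a x}"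
  "Ident (Set_L U L) a = (\<lambda>x \<in> fst a. x)"
  "Comp (Set_L U L) a b c g f = compose (fst a) g f"
  by (auto simp: Set_L_def split_beta)

lemma category_Set_L: "category (Set_L U L)"
proof
  fix a b c f g
  assume "f \<in> Hom (Set_L U L) a b" "g \<in> Hom (Set_L U L) b c"
  then show "Comp (Set_L U L) a b c g f \<in> Hom (Set_L U L) a c"
    by (fastforce simp: Set_L_simps compose_def)
next
  fix a b f assume "f \<in> Hom (Set_L U L) a b"
  then show "Comp (Set_L U L) a b b (Ident (Set_L U L) b) f = f"
    and "Comp (Set_L U L) a a b f (Ident (Set_L U L) a) = f"
    by (auto simp: Set_L_simps compose_def PiE_iff extensional_def fun_eq_iff)
next
  fix a b c d f g h
  assume "f \<in> Hom (Set_L U L) a b" "g \<in> Hom (Set_L U L) b c" "h \<in> Hom (Set_L U L) c d"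
  then show "Comp (Set_L U L) a b d (Comp (Set_L U L) b c d h g) f =
      Comp (Set_L U L) a c d h (Comp (Set_L U L) a b c g f)"
    by (auto simp: Set_L_simps compose_def PiE_iff)
qed (auto simp: Set_L_simps)

locale Set_L_diagram =
  fixes L :: "('f, 'l) algebra" and U :: "'u set set"
    and J :: "('u, 'u) cat" and Y :: "('u, 'u, 'u set \<times> ('u \<Rightarrow> 'l set), 'u \<Rightarrow> 'u) func"
  assumes filtered: "filtered_category J"
    and diagram: "is_functor J (Set_L_fin U L) Y"
begin

sublocale category J
  using filtered by (simp add: filtered_category_def)

abbreviation carr :: "'u \<Rightarrow> 'u set" where
  "carr j \<equiv> fst (on_obj Y j)"

abbreviation lab :: "'u \<Rightarrow> 'u \<Rightarrow> 'l set" where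
  "lab j \<equiv> snd (on_obj Y j)"

lemma
  assumes "j \<in> Obj J"
  shows finite_carr: "finite (carr j)"
    and lab_in_PiE: "lab j \<in> carr j \<rightarrow>\<^sub>E subalgebras L"
  using is_functor.on_obj_in_Obj[OF diagram assms]
  by (auto simp: Set_L_fin_def Set_L_simps split_beta)

lemma
  assumes "j \<in> Obj J" "k \<in> Obj J" "u \<in> Hom J j k"
  shows on_arr_carr: "x \<in> carr j \<Longrightarrow> on_arr Y j k u x \<in> carr k"
    and lab_on_arr: "x \<in> carr j \<Longrightarrow> lab k (on_arr Y j k u x) \<subseteq> lab j x"
  using is_functor.on_arr_in_Hom[OF diagram assms]
  by (auto simp: Set_L_fin_def Set_L_simps)

lemma on_arr_Comp_apply:
  assumes "i \<in> Obj J" "j \<in> Obj J" "k \<in> Obj J" "u \<in> Hom J i j" "w \<in> Hom J j k" "x \<in> carr i"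
  shows "on_arr Y i k (Comp J i j k w u) x = on_arr Y j k w (on_arr Y i j u x)"
  using is_functor.on_arr_Comp[OF diagram assms(1-5)] assms(6)
  by (simp add: Set_L_fin_def Set_L_simps compose_def)

lemma on_arr_Ident_apply:
  assumes "j \<in> Obj J" "x \<in> carr j"
  shows "on_arr Y j j (Ident J j) x = x"
  using is_functor.on_arr_Ident[OF diagram assms(1)] assms(2)
  by (simp add: Set_L_fin_def Set_L_simps)

lemma span_bound:
  assumes "j \<in> Obj J" "j' \<in> Obj J"
  obtains k u u' where "k \<in> Obj J" "u \<in> Hom J j k" "u' \<in> Hom J j' k"
  using filtered assms unfolding filtered_category_def by blast

lemma coequalizing_arrow:
  assumes "j \<in> Obj J" "k \<in> Obj J" "u \<in> Hom J j k" "u' \<in> Hom J j k"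
  obtains l r where "l \<in> Obj J" "r \<in> Hom J k l" "Comp J j k l r u = Comp J j k l r u'"
  using filtered assms unfolding filtered_category_def by blast

lemma finite_bound:
  assumes "finite S" "S \<subseteq> Obj J"
  shows "\<exists>k \<in> Obj J. \<forall>j \<in> S. Hom J j k \<noteq> {}"
  using assms
proof (induction S)
  case empty
  then show ?case using filtered by (auto simp: filtered_category_def)
next
  case (insert i S)
  then obtain k where k: "k \<in> Obj J" "\<forall>j \<in> S. Hom J j k \<noteq> {}" by auto
  obtain l u u' where l: "l \<in> Obj J" "u \<in> Hom J i l" "u' \<in> Hom J k l"
    using span_bound[of i k] insert.prems k by auto
  have "Hom J j l \<noteq> {}" if "j \<in> S" for j
    using that k l insert.prems Comp_in_Hom[of j k l _ u'] by blast
  with l show ?case by blast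
qed

text \<open>\<open>surj\<close> and \<open>inj\<close> describe a filtered colimit of sets, where
  \<open>inj\<close> compares points of one stage since two stages have a common bound. The label
  clause in \<open>surj\<close> says that the label of \<open>p\<close> is attained, the legs giving
  the other inclusion.\<close>

lemma ind_colimitI:
  fixes \<kappa> :: "'u \<Rightarrow> 'u \<Rightarrow> 'u"
  assumes d: "d \<in> Obj (Set_L U L)"
    and leg: "\<And>j. j \<in> Obj J \<Longrightarrow> \<kappa> j \<in> Hom (Set_L U L) (on_obj Y j) d"
    and nat: "\<And>j k u x. \<lbrakk>j \<in> Obj J; k \<in> Obj J; u \<in> Hom J j k; x \<in> carr j\<rbrakk> \<Longrightarrow>
      \<kappa> k (on_arr Y j k u x) = \<kappa> j x"
    and surj: "\<And>p. p \<in> fst d \<Longrightarrow> \<exists>j \<in> Obj J. \<exists>x \<in> carr j. \<kappa> j x = p \<and> lab j x \<subseteq> snd d p"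
    and inj: "\<And>j x y. \<lbrakk>j \<in> Obj J; x \<in> carr j; y \<in> carr j; \<kappa> j x = \<kappa> j y\<rbrakk> \<Longrightarrow>
      \<exists>k \<in> Obj J. \<exists>u \<in> Hom J j k. on_arr Y j k u x = on_arr Y j k u y"
  shows "ind_colimit (Set_L U L) (\<lambda>(X, v). finite X) J Y d \<kappa>"
proof (intro ind_colimit.intro ind_colimit_axioms.intro category_Set_L)
  have leg_carr: "\<kappa> j x \<in> fst d" and leg_lab: "snd d (\<kappa> j x) \<subseteq> lab j x"
    if "j \<in> Obj J" "x \<in> carr j" for j x
    using leg that by (auto simp: Set_L_simps)
  show "is_functor J (full_subcategory (Set_L U L) (\<lambda>(X, v). finite X)) Y"
    using diagram by (simp add: Set_L_fin_def)
  show "d \<in> Obj (Set_L U L)" by (fact d)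
  show "\<kappa> j \<in> Hom (Set_L U L) (on_obj Y j) d" if "j \<in> Obj J" for j
    using leg that .
  show "Comp (Set_L U L) (on_obj Y j) (on_obj Y j') d (\<kappa> j') (on_arr Y j j' u) = \<kappa> j"
    if "j \<in> Obj J" "j' \<in> Obj J" "u \<in> Hom J j j'" for j j' u
    using nat[OF that] leg[OF that(1)] that
    by (auto simp: Set_L_simps compose_def PiE_iff extensional_def fun_eq_iff)
  show "h = h'"
    if "h \<in> Hom (Set_L U L) d e" "h' \<in> Hom (Set_L U L) d e"
      and eq: "\<And>j. j \<in> Obj J \<Longrightarrow> Comp (Set_L U L) (on_obj Y j) d e h (\<kappa> j) =
        Comp (Set_L U L) (on_obj Y j) d e h' (\<kappa> j)" for e h h'
  proof (rule PiE_ext)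
    show "h \<in> fst d \<rightarrow>\<^sub>E fst e" "h' \<in> fst d \<rightarrow>\<^sub>E fst e" using that by (auto simp: Set_L_simps)
    fix p assume "p \<in> fst d"
    then obtain j x where "j \<in> Obj J" "x \<in> carr j" "\<kappa> j x = p" using surj by blast
    then show "h p = h' p"
      using fun_cong[OF eq, of j x] by (simp add: Set_L_simps compose_def)
  qed
  show "\<exists>h \<in> Hom (Set_L U L) d e. \<forall>j \<in> Obj J. Comp (Set_L U L) (on_obj Y j) d e h (\<kappa> j) = l j"
    if l: "\<And>j. j \<in> Obj J \<Longrightarrow> l j \<in> Hom (Set_L U L) (on_obj Y j) e"
      and comp: "\<And>j k u. \<lbrakk>j \<in> Obj J; k \<in> Obj J; u \<in> Hom J j k\<rbrakk> \<Longrightarrow>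
        Comp (Set_L U L) (on_obj Y j) (on_obj Y k) e (l k) (on_arr Y j k u) = l j" for e l
  proof -
    have l_nat: "l k (on_arr Y j k u x) = l j x"
      if "j \<in> Obj J" "k \<in> Obj J" "u \<in> Hom J j k" "x \<in> carr j" for j k u x
      using fun_cong[OF comp[OF that(1-3)], of x] that(4) by (simp add: Set_L_simps compose_def)
    have l_eq: "l j x = l j' x'"
      if j: "j \<in> Obj J" "x \<in> carr j" and j': "j' \<in> Obj J" "x' \<in> carr j'" and eq: "\<kappa> j x = \<kappa> j' x'"
      for j x j' x'
    proof -
      obtain k u u' where k: "k \<in> Obj J" "u \<in> Hom J j k" "u' \<in> Hom J j' k"
        using span_bound[OF j(1) j'(1)] .
      have "\<kappa> k (on_arr Y j k u x) = \<kappa> k (on_arr Y j' k u' x')"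
        using j j' k eq by (simp add: nat)
      then obtain k' r where k': "k' \<in> Obj J" "r \<in> Hom J k k'"
        "on_arr Y k k' r (on_arr Y j k u x) = on_arr Y k k' r (on_arr Y j' k u' x')"
        using inj[OF k(1)] on_arr_carr j j' k by blast
      show ?thesis
        using l_nat[OF k(1) k'(1,2), of "on_arr Y j k u x"]
          l_nat[OF k(1) k'(1,2), of "on_arr Y j' k u' x'"] l_nat on_arr_carr j j' k k'(3) by simp
    qed
    \<comment> \<open>Representatives attaining the label of \<open>p\<close> make \<open>h\<close>
      an arrow: the label of \<open>h p\<close> lies in \<open>lab (\<iota> p) (\<xi> p)\<close>,
      hence in \<open>snd d p\<close>.\<close>
    obtain \<iota> \<xi> where rep: "\<And>p. p \<in> fst d \<Longrightarrow> \<iota> p \<in> Obj J" "\<And>p. p \<in> fst d \<Longrightarrow> \<xi> p \<in> carr (\<iota> p)"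
      "\<And>p. p \<in> fst d \<Longrightarrow> \<kappa> (\<iota> p) (\<xi> p) = p" "\<And>p. p \<in> fst d \<Longrightarrow> lab (\<iota> p) (\<xi> p) \<subseteq> snd d p"
      using surj by metis
    define h where "h = (\<lambda>p \<in> fst d. l (\<iota> p) (\<xi> p))"
    have "h \<in> Hom (Set_L U L) d e"
      using l rep by (fastforce simp: h_def Set_L_simps)
    moreover have "h (\<kappa> j x) = l j x" if "j \<in> Obj J" "x \<in> carr j" for j x
      using that rep leg_carr[OF that] by (auto simp: h_def intro: l_eq)
    then have "Comp (Set_L U L) (on_obj Y j) d e h (\<kappa> j) = l j" if "j \<in> Obj J" for j
      using l[OF that] that
      by (auto simp: Set_L_simps compose_def PiE_iff extensional_def fun_eq_iff)
    ultimately show ?thesis by blast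
  qed
  show "\<exists>j \<in> Obj J. \<exists>f \<in> Hom (Set_L U L) c (on_obj Y j).
      Comp (Set_L U L) c (on_obj Y j) d (\<kappa> j) f = m"
    if c: "case c of (X, v) \<Rightarrow> finite X" and m: "m \<in> Hom (Set_L U L) c d" for c m
  proof -
    have m': "m x \<in> fst d" "snd d (m x) \<subseteq> snd c x" if "x \<in> fst c" for x
      using m that by (auto simp: Set_L_simps)
    have "\<exists>i y. x \<in> fst c \<longrightarrow> i \<in> Obj J \<and> y \<in> carr i \<and> \<kappa> i y = m x \<and> lab i y \<subseteq> snd d (m x)" for x
      using surj m'(1) by blast
    then obtain \<iota> \<xi> where rep: "\<And>x. x \<in> fst c \<Longrightarrow> \<iota> x \<in> Obj J" "\<And>x. x \<in> fst c \<Longrightarrow> \<xi> x \<in> carr (\<iota> x)"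
      "\<And>x. x \<in> fst c \<Longrightarrow> \<kappa> (\<iota> x) (\<xi> x) = m x"
      "\<And>x. x \<in> fst c \<Longrightarrow> lab (\<iota> x) (\<xi> x) \<subseteq> snd d (m x)"
      by metis
    \<comment> \<open>Finiteness of \<open>c\<close> enters: its points have finitely many
      representatives, which all move to one stage \<open>k\<close>. Moving only shrinks labels, so
      the lift remains an arrow.\<close>
    have "finite (\<iota> ` fst c)" "\<iota> ` fst c \<subseteq> Obj J" using c rep(1) by (auto simp: split_beta)
    from finite_bound[OF this] obtain k
      where k: "k \<in> Obj J" "\<forall>j \<in> \<iota> ` fst c. Hom J j k \<noteq> {}" by (elim bexE)
    then have "\<forall>x \<in> fst c. \<exists>u. u \<in> Hom J (\<iota> x) k" by auto
    with k(1) obtain u where k: "k \<in> Obj J" "\<And>x. x \<in> fst c \<Longrightarrow> u x \<in> Hom J (\<iota> x) k"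
      by metis
    define f where "f = (\<lambda>x \<in> fst c. on_arr Y (\<iota> x) k (u x) (\<xi> x))"
    have "lab k (on_arr Y (\<iota> x) k (u x) (\<xi> x)) \<subseteq> snd c x" if "x \<in> fst c" for x
      using lab_on_arr[OF rep(1) k(1) k(2) rep(2)] rep(4) m'(2) that by blast
    then have "f \<in> Hom (Set_L U L) c (on_obj Y k)"
      using rep k by (auto simp: f_def Set_L_simps intro: on_arr_carr)
    moreover have "Comp (Set_L U L) c (on_obj Y k) d (\<kappa> k) f = m"
      using m rep k by (auto simp: f_def Set_L_simps compose_def nat PiE_iff extensional_def fun_eq_iff)
    ultimately show ?thesis using k by blast
  qed
  show "\<exists>k \<in> Obj J. \<exists>p \<in> Hom J j k. \<exists>q \<in> Hom J j' k.
      Comp (Set_L U L) c (on_obj Y j) (on_obj Y k) (on_arr Y j k p) f =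
      Comp (Set_L U L) c (on_obj Y j') (on_obj Y k) (on_arr Y j' k q) f'"
    if c: "case c of (X, v) \<Rightarrow> finite X" and j: "j \<in> Obj J" and j': "j' \<in> Obj J"
      and f: "f \<in> Hom (Set_L U L) c (on_obj Y j)" and f': "f' \<in> Hom (Set_L U L) c (on_obj Y j')"
      and eq: "Comp (Set_L U L) c (on_obj Y j) d (\<kappa> j) f = Comp (Set_L U L) c (on_obj Y j') d (\<kappa> j') f'"
    for c j j' f f'
  proof -
    have fx: "f x \<in> carr j" "f' x \<in> carr j'" "\<kappa> j (f x) = \<kappa> j' (f' x)" if "x \<in> fst c" for x
      using that f f' fun_cong[OF eq, of x] by (auto simp: Set_L_simps compose_def)
    obtain k p q where k: "k \<in> Obj J" and p: "p \<in> Hom J j k" and q: "q \<in> Hom J j' k"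
      using span_bound[OF j j'] .
    define y where "y x = on_arr Y j k p (f x)" for x
    define y' where "y' x = on_arr Y j' k q (f' x)" for x
    have y: "y x \<in> carr k" "y' x \<in> carr k" "\<kappa> k (y x) = \<kappa> k (y' x)" if "x \<in> fst c" for x
      using fx[OF that] j j' k p q by (simp_all add: y_def y'_def nat on_arr_carr)
    \<comment> \<open>One more point is equalized at each step; equalities reached earlier persist
      at later stages.\<close>
    have "\<exists>l \<in> Obj J. \<exists>r \<in> Hom J k l. \<forall>x \<in> S. on_arr Y k l r (y x) = on_arr Y k l r (y' x)"
      if "finite S" "S \<subseteq> fst c" for S
      using that
    proof (induction S)
      case empty
      then show ?case using k Ident_in_Hom by blast
    next
      case (insert x S)
      then obtain l r where l: "l \<in> Obj J" "r \<in> Hom J k l"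
        "\<And>z. z \<in> S \<Longrightarrow> on_arr Y k l r (y z) = on_arr Y k l r (y' z)" by auto
      have x: "x \<in> fst c" using insert.prems by blast
      then have "\<kappa> l (on_arr Y k l r (y x)) = \<kappa> l (on_arr Y k l r (y' x))"
        using y k l by (simp add: nat)
      then obtain l' s where l': "l' \<in> Obj J" "s \<in> Hom J l l'"
        "on_arr Y l l' s (on_arr Y k l r (y x)) = on_arr Y l l' s (on_arr Y k l r (y' x))"
        using inj[OF l(1)] on_arr_carr[OF k l(1,2)] y x by blast
      have "on_arr Y k l' (Comp J k l l' s r) (y z) = on_arr Y k l' (Comp J k l l' s r) (y' z)"
        if "z \<in> insert x S" for z
        using that insert.prems y k l l' by (auto simp: on_arr_Comp_apply subset_iff)
      moreover have "Comp J k l l' s r \<in> Hom J k l'" using k l l' Comp_in_Hom by blast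
      ultimately show ?case using l' by blast
    qed
    from this[of "fst c"] obtain l r where l: "l \<in> Obj J" "r \<in> Hom J k l"
      "\<And>x. x \<in> fst c \<Longrightarrow> on_arr Y k l r (y x) = on_arr Y k l r (y' x)"
      using c by (auto simp: split_beta)
    have "Comp J j k l r p \<in> Hom J j l" "Comp J j' k l r q \<in> Hom J j' l"
      using j j' k p q l Comp_in_Hom by blast+
    moreover have "Comp (Set_L U L) c (on_obj Y j) (on_obj Y l) (on_arr Y j l (Comp J j k l r p)) f =
        Comp (Set_L U L) c (on_obj Y j') (on_obj Y l) (on_arr Y j' l (Comp J j' k l r q)) f'"
      using l(3) fx j j' k p q l(1,2)
      by (auto simp: Set_L_simps compose_def on_arr_Comp_apply y_def y'_def fun_eq_iff)
    ultimately show ?thesis using l(1) by blast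
  qed
qed

text \<open>The points of the colimit are codes of representatives of the classes of the pairs
  \<open>(j, x)\<close> with \<open>x\<close> in the \<open>j\<close>-th set.\<close>

lemma ind_colimit_exists:
  assumes U: "set_universe U" and J: "Obj J \<in> U" and fin: "finite (UNIV :: 'l set)"
  shows "\<exists>d \<kappa>. ind_colimit (Set_L U L) (\<lambda>(X, v). finite X) J Y d \<kappa>"
proof -
  let ?S = "SIGMA j : Obj J. carr j"
  define rel where "rel = (\<lambda>(j, x) (j', x'). \<exists>k \<in> Obj J. \<exists>u \<in> Hom J j k. \<exists>u' \<in> Hom J j' k.
    on_arr Y j k u x = on_arr Y j' k u' x')"
  have rel_refl: "rel s s" if "s \<in> ?S" for s
    using that Ident_in_Hom by (fastforce simp: rel_def)
  have rel_sym: "rel t s" if "rel s t" for s t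
    using that unfolding rel_def by (cases s; cases t; simp) metis
  have rel_on_arr: "rel (k, on_arr Y j k u x) (j, x)"
    if "j \<in> Obj J" "k \<in> Obj J" "u \<in> Hom J j k" "x \<in> carr j" for j k u x
  proof -
    have "on_arr Y k k (Ident J k) (on_arr Y j k u x) = on_arr Y j k u x"
      using that by (simp add: on_arr_Ident_apply on_arr_carr)
    then show ?thesis using that Ident_in_Hom[of k] unfolding rel_def by blast
  qed
  have rel_trans: "rel s t''" if S: "s \<in> ?S" "t \<in> ?S" "t'' \<in> ?S" and rel: "rel s t" "rel t t''"
    for s t t''
  proof -
    obtain i x j y m z where st: "s = (i, x)" "t = (j, y)" "t'' = (m, z)"
      by (metis prod.exhaust)
    have i: "i \<in> Obj J" "x \<in> carr i" and j: "j \<in> Obj J" "y \<in> carr j" and m: "m \<in> Obj J" "z \<in> carr m"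
      using S st by auto
    obtain k u v where k: "k \<in> Obj J" "u \<in> Hom J i k" "v \<in> Hom J j k" "on_arr Y i k u x = on_arr Y j k v y"
      using rel(1) by (auto simp: rel_def st)
    obtain l v' w where l: "l \<in> Obj J" "v' \<in> Hom J j l" "w \<in> Hom J m l" "on_arr Y j l v' y = on_arr Y m l w z"
      using rel(2) by (auto simp: rel_def st)
    \<comment> \<open>The middle point \<open>y\<close> reaches \<open>n\<close> along two arrows
      that may differ; \<open>r\<close> coequalizes them.\<close>
    obtain n a b where n: "n \<in> Obj J" "a \<in> Hom J k n" "b \<in> Hom J l n"
      using span_bound[OF k(1) l(1)] .
    have arr: "Comp J j k n a v \<in> Hom J j n" "Comp J j l n b v' \<in> Hom J j n"
      using j k l n Comp_in_Hom by blast+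
    obtain q r where q: "q \<in> Obj J" "r \<in> Hom J n q"
      "Comp J j n q r (Comp J j k n a v) = Comp J j n q r (Comp J j l n b v')"
      using coequalizing_arrow[OF j(1) n(1) arr] .
    have arr': "Comp J i k n a u \<in> Hom J i n" "Comp J m l n b w \<in> Hom J m n"
      using i m k l n Comp_in_Hom by blast+
    have "on_arr Y i q (Comp J i n q r (Comp J i k n a u)) x =
        on_arr Y j q (Comp J j n q r (Comp J j k n a v)) y"
      using i j k n q(1,2) arr arr' by (simp add: on_arr_Comp_apply)
    also have "\<dots> = on_arr Y m q (Comp J m n q r (Comp J m l n b w)) z"
      unfolding q(3) using m j l n q(1,2) arr arr' by (simp add: on_arr_Comp_apply)
    finally show ?thesis
      using q(1) Comp_in_Hom[OF i(1) n(1) q(1) arr'(1) q(2)] Comp_in_Hom[OF m(1) n(1) q(1) arr'(2) q(2)]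
      unfolding rel_def st by blast
  qed
  obtain e where e: "inj_on e ?S" "e ` ?S \<in> U"
    using Sigma_universe_encoding[OF U J, of carr] finite_carr by blast
  \<comment> \<open>The predicate under \<open>SOME\<close> depends only on the class of
    \<open>s\<close>, so equivalent pairs receive the very same representative.\<close>
  define rep where "rep s = (SOME t. t \<in> ?S \<and> rel s t)" for s
  have rep: "rep s \<in> ?S" "rel s (rep s)" if "s \<in> ?S" for s
    using someI[of "\<lambda>t. t \<in> ?S \<and> rel s t" s] rel_refl[OF that] that by (simp_all add: rep_def)
  have rep_eq: "rep s = rep t \<longleftrightarrow> rel s t" if "s \<in> ?S" "t \<in> ?S" for s t
  proof
    assume "rep s = rep t"
    then show "rel s t"
      using rel_trans[of s "rep s" t] rep[OF that(1)] rep[OF that(2)] rel_sym that by metis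
  next
    assume "rel s t"
    then have "r \<in> ?S \<and> rel s r \<longleftrightarrow> r \<in> ?S \<and> rel t r" for r
      using rel_trans rel_sym that by blast
    then show "rep s = rep t" by (simp add: rep_def)
  qed
  define \<kappa> where "\<kappa> j = (\<lambda>x \<in> carr j. e (rep (j, x)))" for j
  have \<kappa>_eq: "\<kappa> j x = \<kappa> j' x' \<longleftrightarrow> rel (j, x) (j', x')"
    if "(j, x) \<in> ?S" "(j', x') \<in> ?S" for j x j' x'
    using that rep_eq[OF that] inj_on_eq_iff[OF e(1) rep(1)[OF that(1)] rep(1)[OF that(2)]]
    by (simp add: \<kappa>_def)
  define A where "A = (\<lambda>(j, x). \<kappa> j x) ` ?S"
  have A: "A \<in> U"
    using rep(1) by (intro set_universeD(1)[OF U e(2)]) (auto simp: A_def \<kappa>_def)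
  define least where "least p i x \<longleftrightarrow> (i, x) \<in> ?S \<and> \<kappa> i x = p \<and>
      (\<forall>j y. (j, y) \<in> ?S \<longrightarrow> \<kappa> j y = p \<longrightarrow> lab i x \<subseteq> lab j y)" for p i x
  have "\<exists>i x. p \<in> A \<longrightarrow> least p i x" for p
  proof (cases "p \<in> A")
    case True
    let ?R = "\<lambda>(i, x). (i, x) \<in> ?S \<and> \<kappa> i x = p"
    obtain s where "?R s" using True by (auto simp: A_def)
    then obtain i x where ix: "(i, x) \<in> ?S" "\<kappa> i x = p"
      "\<And>j y. \<lbrakk>(j, y) \<in> ?S; \<kappa> j y = p\<rbrakk> \<Longrightarrow> card (lab i x) \<le> card (lab j y)"
      using ex_has_least_nat[of ?R s "\<lambda>(i, x). card (lab i x)"] by auto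
    \<comment> \<open>Smallest cardinality gives least label: both pairs meet in a point
      \<open>z\<close> of a later stage whose label lies in both labels, and minimality forces
      \<open>lab k z = lab i x\<close>.\<close>
    have "lab i x \<subseteq> lab j y" if jy: "(j, y) \<in> ?S" "\<kappa> j y = p" for j y
    proof -
      have "rel (i, x) (j, y)" using \<kappa>_eq[OF ix(1) jy(1)] ix(2) jy(2) by simp
      then obtain k u u' where k: "k \<in> Obj J" "u \<in> Hom J i k" "u' \<in> Hom J j k"
        "on_arr Y i k u x = on_arr Y j k u' y" by (auto simp: rel_def)
      define z where "z = on_arr Y i k u x"
      have z: "z \<in> carr k" "lab k z \<subseteq> lab i x" "lab k z \<subseteq> lab j y"
        using ix(1) jy(1) k on_arr_carr lab_on_arr[of i k u x] lab_on_arr[of j k u' y]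
        by (auto simp: z_def)
      have "rel (k, z) (i, x)" unfolding z_def using k ix(1) by (intro rel_on_arr) auto
      then have "\<kappa> k z = p" using \<kappa>_eq[of k z i x] ix(1,2) k(1) z(1) by simp
      then have "card (lab i x) \<le> card (lab k z)" using ix(3) k(1) z(1) by simp
      then have "lab k z = lab i x"
        using z(2) finite_subset[OF subset_UNIV fin] by (intro card_seteq) auto
      then show ?thesis using z(3) by simp
    qed
    then show ?thesis using ix unfolding least_def by blast
  qed simp
  then obtain \<iota> \<xi> where "\<And>p. p \<in> A \<Longrightarrow> least p (\<iota> p) (\<xi> p)" by metis
  then have min: "\<And>p. p \<in> A \<Longrightarrow> (\<iota> p, \<xi> p) \<in> ?S"
    "\<And>p. p \<in> A \<Longrightarrow> \<kappa> (\<iota> p) (\<xi> p) = p"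
    "\<And>p j y. \<lbrakk>p \<in> A; (j, y) \<in> ?S; \<kappa> j y = p\<rbrakk> \<Longrightarrow> lab (\<iota> p) (\<xi> p) \<subseteq> lab j y"
    by (simp_all add: least_def)
  define w where "w = (\<lambda>p \<in> A. lab (\<iota> p) (\<xi> p))"
  have "ind_colimit (Set_L U L) (\<lambda>(X, v). finite X) J Y (A, w) \<kappa>"
  proof (rule ind_colimitI)
    have "w p \<in> subalgebras L" if "p \<in> A" for p
      using that min(1)[OF that] lab_in_PiE by (auto simp: w_def)
    then show "(A, w) \<in> Obj (Set_L U L)"
      using A by (auto simp: Set_L_simps w_def)
  next
    fix j assume j: "j \<in> Obj J"
    then have "\<kappa> j x \<in> A" if "x \<in> carr j" for x using that by (auto simp: A_def)
    then show "\<kappa> j \<in> Hom (Set_L U L) (on_obj Y j) (A, w)"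
      using j min(3) by (auto simp: Set_L_simps w_def \<kappa>_def extensional_def)
  next
    fix j k u x assume *: "j \<in> Obj J" "k \<in> Obj J" "u \<in> Hom J j k" "x \<in> carr j"
    then have "on_arr Y j k u x \<in> carr k" by (rule on_arr_carr)
    then show "\<kappa> k (on_arr Y j k u x) = \<kappa> j x"
      using * rel_on_arr by (simp add: \<kappa>_eq)
  next
    fix p assume "p \<in> fst (A, w)"
    then show "\<exists>j \<in> Obj J. \<exists>x \<in> carr j. \<kappa> j x = p \<and> lab j x \<subseteq> snd (A, w) p"
      using min(1,2)[of p] by (auto simp: w_def)
  next
    fix j x y assume j: "j \<in> Obj J" "x \<in> carr j" "y \<in> carr j" "\<kappa> j x = \<kappa> j y"
    then have "rel (j, x) (j, y)" by (simp add: \<kappa>_eq)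
    then obtain k u u' where k: "k \<in> Obj J" "u \<in> Hom J j k" "u' \<in> Hom J j k"
      "on_arr Y j k u x = on_arr Y j k u' y" by (auto simp: rel_def)
    \<comment> \<open>\<open>rel\<close> moves \<open>x\<close> and \<open>y\<close> along possibly
      different arrows, whereas a single one is wanted; coequalizing \<open>u\<close> and
      \<open>u'\<close> provides it.\<close>
    obtain l r where l: "l \<in> Obj J" "r \<in> Hom J k l" "Comp J j k l r u = Comp J j k l r u'"
      using coequalizing_arrow[OF j(1) k(1-3)] .
    have "on_arr Y j l (Comp J j k l r u) x = on_arr Y j l (Comp J j k l r u) y"
      using j k l on_arr_Comp_apply[of j k l u r x] on_arr_Comp_apply[of j k l u' r y] by simp
    then show "\<exists>k \<in> Obj J. \<exists>u \<in> Hom J j k. on_arr Y j k u x = on_arr Y j k u y"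
      using Comp_in_Hom[OF j(1) k(1) l(1) k(2) l(2)] l(1) by blast
  qed
  then show ?thesis by blast
qed

end

text \<open>Finite subsets are directed by union, inclusions keep labels, and each point
  \<open>p\<close> already has its own label in the stage coding \<open>{p}\<close>.\<close>

lemma finite_subsets_ind_colimit:
  fixes L :: "('f, 'l) algebra" and U :: "'u set set"
  assumes U: "set_universe U" and d: "d \<in> Obj (Set_L U L)"
  shows "\<exists>J Y \<kappa>. (J, Y) \<in> filtered_diagrams U (Set_L_fin U L) \<and>
    ind_colimit (Set_L U L) (\<lambda>(X, v). finite X) J Y d \<kappa>"
proof -
  obtain X v where Xv: "d = (X, v)" "X \<in> U" "v \<in> X \<rightarrow>\<^sub>E subalgebras L"
    using d by (cases d) (auto simp: Set_L_simps)
  obtain e where e: "inj_on e (Fpow X)" "e ` Fpow X \<in> U"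
    using Fpow_universe_encoding[OF U Xv(2)] .
  define s where "s = inv_into (Fpow X) e"
  have s_e [simp]: "s (e S) = S" if "S \<in> Fpow X" for S using e(1) that by (simp add: s_def)
  \<comment> \<open>The inclusion order as a category on codes, decoded by \<open>s\<close>. The
    single arrow of a nonempty hom-set may be any element of \<open>'u\<close>;
    \<open>undefined\<close> is taken.\<close>
  define J :: "('u, 'u) cat" where "J = \<lparr>Obj = e ` Fpow X,
    Hom = \<lambda>i j. if s i \<subseteq> s j then {undefined} else {},
    Ident = \<lambda>_. undefined, Comp = \<lambda>_ _ _ _ _. undefined\<rparr>"
  define Y :: "('u, 'u, 'u set \<times> ('u \<Rightarrow> 'l set), 'u \<Rightarrow> 'u) func" where
    "Y = \<lparr>on_obj = \<lambda>i. (s i, restrict v (s i)), on_arr = \<lambda>i _ _. \<lambda>x \<in> s i. x\<rparr>"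
  have Obj_J: "Obj J = e ` Fpow X" and Hom_J: "u \<in> Hom J i j \<longleftrightarrow> s i \<subseteq> s j \<and> u = undefined" for i j u
    by (simp_all add: J_def)
  have s: "s i \<subseteq> X" "finite (s i)" if "i \<in> Obj J" for i
    using that by (auto simp: Obj_J Fpow_def)
  have cat: "category J"
    by standard (auto simp: J_def split: if_splits)
  have empty: "e {} \<in> Obj J" by (simp add: Obj_J empty_in_Fpow)
  have union: "e (s i \<union> s j) \<in> Obj J" "s (e (s i \<union> s j)) = s i \<union> s j"
    if "i \<in> Obj J" "j \<in> Obj J" for i j
  proof -
    have "s i \<union> s j \<in> Fpow X" using s[OF that(1)] s[OF that(2)] by (simp add: Fpow_def)
    then show "e (s i \<union> s j) \<in> Obj J" "s (e (s i \<union> s j)) = s i \<union> s j" by (simp_all add: Obj_J)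
  qed
  have "\<exists>k \<in> Obj J. Hom J i k \<noteq> {} \<and> Hom J j k \<noteq> {}" if "i \<in> Obj J" "j \<in> Obj J" for i j
    using union[OF that] by (intro bexI[of _ "e (s i \<union> s j)"]) (auto simp: J_def)
  moreover have "\<exists>k \<in> Obj J. \<exists>r \<in> Hom J j k. Comp J i j k r p = Comp J i j k r q"
    if "j \<in> Obj J" for i j p q
    using that by (intro bexI[of _ j] bexI[of _ undefined]) (auto simp: J_def)
  ultimately have filt: "filtered_category J"
    unfolding filtered_category_def using cat empty by blast
  have func: "is_functor J (Set_L_fin U L) Y"
  proof
    fix i assume i: "i \<in> Obj J"
    show "on_obj Y i \<in> Obj (Set_L_fin U L)"
      using s[OF i] Xv set_universeD(1)[OF U Xv(2)]
      by (auto simp: Set_L_fin_def Set_L_simps Y_def)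
  qed (use s in \<open>auto simp: Set_L_fin_def Set_L_simps Y_def Hom_J compose_def fun_eq_iff\<close>)
  have "{} \<in> U" using set_universeD(1)[OF U Xv(2)] by blast
  then have "small_category U J"
    using cat e(2) singleton_in_universe[OF U] by (simp add: small_category_def J_def)
  then have "(J, Y) \<in> filtered_diagrams U (Set_L_fin U L)"
    using filt func by (simp add: filtered_diagrams_def)
  moreover
  interpret Set_L_diagram L U J Y using filt func by (rule Set_L_diagram.intro)
  have "ind_colimit (Set_L U L) (\<lambda>(X, v). finite X) J Y d (\<lambda>i. \<lambda>x \<in> s i. x)"
  proof (rule ind_colimitI)
    fix p assume "p \<in> fst d"
    then have "{p} \<in> Fpow X" by (simp add: Xv Fpow_def)
    then show "\<exists>j \<in> Obj J. \<exists>x \<in> carr j. (\<lambda>x \<in> s j. x) x = p \<and> lab j x \<subseteq> snd d p"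
      by (intro bexI[of _ "e {p}"] bexI[of _ p]) (simp_all add: Xv Y_def Obj_J)
  next
    fix j x y
    assume "j \<in> Obj J" "x \<in> carr j" "y \<in> carr j" "(\<lambda>x \<in> s j. x) x = (\<lambda>x \<in> s j. x) y"
    then show "\<exists>k \<in> Obj J. \<exists>u \<in> Hom J j k. on_arr Y j k u x = on_arr Y j k u y"
      \<comment> \<open>Legs are inclusions, so the two points are already equal and the identity of
        \<open>j\<close> serves.\<close>
      by (intro bexI[of _ j] bexI[of _ undefined]) (simp_all add: Hom_J Y_def)
  qed (use d s in \<open>auto simp: Xv Set_L_simps Y_def Hom_J\<close>)
  ultimately show ?thesis by blast
qed

theorem theorem5p5:
  fixes L :: "('f, 'l :: {finite, bounded_lattice}) algebra"
    and U :: "'u set set"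
  assumes "bounded_lattice_in_signature L"
    and "(bot :: 'l) \<noteq> top"
    and "semi_primal L"
    and "set_universe U"
  shows "equivalent_categories (Ind U (Set_L_fin U L)) (Set_L U L)"
  unfolding Set_L_fin_def
proof (rule Ind_full_subcategory_equivalent[OF category_Set_L])
  fix J Y
  assume "(J, Y) \<in> filtered_diagrams U (full_subcategory (Set_L U L) (\<lambda>(X, v). finite X))"
  then have "filtered_category J" "is_functor J (Set_L_fin U L) Y" "Obj J \<in> U"
    by (simp_all add: filtered_diagrams_def small_category_def Set_L_fin_def)
  then show "\<exists>d \<kappa>. ind_colimit (Set_L U L) (\<lambda>(X, v). finite X) J Y d \<kappa>"
    using assms(4) by (intro Set_L_diagram.ind_colimit_exists Set_L_diagram.intro) auto
next
  fix d assume "d \<in> Obj (Set_L U L)"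
  then show "\<exists>J Y \<kappa>. (J, Y) \<in> filtered_diagrams U (full_subcategory (Set_L U L) (\<lambda>(X, v). finite X)) \<and>
      ind_colimit (Set_L U L) (\<lambda>(X, v). finite X) J Y d \<kappa>"
    using finite_subsets_ind_colimit[OF assms(4)] by (simp flip: Set_L_fin_def)
qed

end
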